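(* Let $C$ be a linear code of length $n$ over a finite commutative principal ideal ring $R$, and let $\lambda$ be a positive integer. Then $$\mathrm{sse}^{[\lambda]}_{C^\perp}(\mathbf{X})=\frac{1}{|C|^\lambda}\,\mathrm{sse}^{[\lambda]}_C\big(\mathbf{Q}\mathbf{D}^\lambda\mathbf{A}^{-1}\mathbf{X}\big),$$ where $\mathbf{Q},\mathbf{D},\mathbf{A}$ are the $(t+1)\times(t+1)$ matrices with rows and columns indexed by $\{0,1,\dots,t\}$ defined as follows: $\mathbf A$ has $(i,j)$ entry $1$ if $a_iR\subseteq a_jR$ and $0$ otherwise; $\mathbf D$ is diagonal with diagonal entries $|a_0R|,\dots,|a_tR|$; and $\mathbf Q$ has $(i,j)$ entry $1$ if $a_jR\subseteq(a_iR)^\perp$ and $0$ otherwise. Consequently, $$\big(\mathbf{Q}\mathbf{D}^\lambda\mathbf{A}^{-1}\big)^2=|R|^\lambda\,\mathbf{I},$$ where $\mathbf I$ is the $(t+1)\times(t+1)$ identity matrix.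
   Context: Rings have an identity. A finite commutative principal ideal ring is a finite commutative ring in which every ideal has the form $aR=\{ab:b\in R\}$ for some $a\in R$. A linear code $C$ of length $n$ over $R$ is an $R$-submodule of $R^n$; $C^\perp=\{\mathbf v\in R^n: \sum_{\ell=1}^n u_\ell v_\ell=0\text{ for all }\mathbf u\in C\}$. For $c\in R$, $(cR)^\perp=\{r\in R: cr=0\}$. Let $[n]=\{1,\dots,n\}$. Let $t$ be the number of nonzero principal ideals of $R$ and let $a_0,\dots,a_t\in R$ be fixed elements such that $a_0R,\dots,a_tR$ are pairwise distinct (hence are all the principal ideals of $R$). For $\mathbf c_m=(c_{m1},\dots,c_{mn})\in C$, $m=1,\dots,\lambda$, let $$S^{[\lambda]}_i(\mathbf c_1,\dots,\mathbf c_\lambda)=\{\ell\in[n]: c_{1\ell}R+\cdots+c_{\lambda\ell}R=a_iR\},\qquad 0\le i\le t.$$ $t\cdot[n]$ is the multiset with underlying set $[n]$ in which each element appears exactly $t$ times. For a multiset $Z\subseteq t\cdot[n]$ and $0\le i\le t$, $M_i(Z)$ is the set of $\ell\in[n]$ with multiplicity exactly $i$ in $Z$. Put $A^{[\lambda]}_C(Z)=|\{(\mathbf c_1,\dots,\mathbf c_\lambda)\in C^\lambda: S^{[\lambda]}_i(\mathbf c_1,\dots,\mathbf c_\lambda)=M_i(Z)\text{ for all }i=0,\dots,t\}|$. Let $\mathbf X=(x_{i\ell})$ be a matrix of indeterminates with rows indexed by $\{0,\dots,t\}$ and columns by $[n]$. The $\lambda$-tuple symmetrized support enumerator of $C$ is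 $$\mathrm{sse}^{[\lambda]}_C(\mathbf X)=\sum_{Z\subseteq t\cdot[n]}A^{[\lambda]}_C(Z)\prod_{i=0}^t\prod_{\ell\in M_i(Z)}x_{i\ell}.$$ For a $(t+1)\times(t+1)$ matrix $\mathbf M$, $\mathrm{sse}^{[\lambda]}_C(\mathbf M\mathbf X)$ means substituting the $(i,\ell)$ entry of $\mathbf M\mathbf X$ for $x_{i\ell}$. The matrix $\mathbf A$ is invertible. *)

theory Defs
  imports
    "HOL-Algebra.Ideal"
    "HOL-Algebra.Module"
    "HOL-Library.FuncSet"
    "HOL-Library.Multiset"
    "HOL-Library.Poly_Mapping"
    "Jordan_Normal_Form.Gauss_Jordan_Elimination"
begin

locale finite_principal_ring = cring R for R (structure) +
  assumes finite_carrier: "finite (carrier R)"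
    and ideal_principal: "ideal I R \<Longrightarrow> \<exists>a\<in>carrier R. I = PIdl a"

definition annihilator :: "('r, 'm) ring_scheme \<Rightarrow> 'r \<Rightarrow> 'r set" where
  "annihilator R c = {r \<in> carrier R. c \<otimes>\<^bsub>R\<^esub> r = \<zero>\<^bsub>R\<^esub>}"


text \<open>The module \<open>R\<^sup>n\<close>, with coordinates indexed by \<open>{1..n}\<close>. The vectors are extensional
  functions, so that they are determined by their coordinates and codes are finite sets.
  The fields \<open>mult\<close> and \<open>one\<close> are an artefact of the record type and carry no meaning.\<close>

definition power_module :: "('r, 'm) ring_scheme \<Rightarrow> nat \<Rightarrow> ('r, nat \<Rightarrow> 'r) module" where
  "power_module R n =
    \<lparr>carrier = {1..n} \<rightarrow>\<^sub>E carrier R,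
     monoid.mult = undefined,
     monoid.one = undefined,
     zero = (\<lambda>l\<in>{1..n}. \<zero>\<^bsub>R\<^esub>),
     add = (\<lambda>u v. \<lambda>l\<in>{1..n}. u l \<oplus>\<^bsub>R\<^esub> v l),
     smult = (\<lambda>r v. \<lambda>l\<in>{1..n}. r \<otimes>\<^bsub>R\<^esub> v l)\<rparr>"

lemma (in cring) module_power_module: "module R (power_module R n)"
proof -
  let ?M = "power_module R n"
  have coord: "x l \<in> carrier R" if "x \<in> carrier ?M" "l \<in> {1..n}" for x l
    using that PiE_mem[of x "{1..n}" "\<lambda>_. carrier R" l] by (simp add: power_module_def)
  have eqI: "x = y" if "x \<in> carrier ?M" "y \<in> carrier ?M" "\<And>l. l \<in> {1..n} \<Longrightarrow> x l = y l" for x y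
    using that by (intro PiE_ext[of _ "{1..n}" "\<lambda>_. carrier R"]) (simp_all add: power_module_def)
  have add: "x \<oplus>\<^bsub>?M\<^esub> y = (\<lambda>l\<in>{1..n}. x l \<oplus> y l)"
    and smult: "r \<odot>\<^bsub>?M\<^esub> y = (\<lambda>l\<in>{1..n}. r \<otimes> y l)"
    and zero: "\<zero>\<^bsub>?M\<^esub> = (\<lambda>l\<in>{1..n}. \<zero>)" for r x y
    by (simp_all add: power_module_def)
  have closed: "(\<lambda>l\<in>{1..n}. f l) \<in> carrier ?M" if "\<And>l. l \<in> {1..n} \<Longrightarrow> f l \<in> carrier R" for f
    using that by (auto simp: power_module_def)
  have add_closed: "x \<oplus>\<^bsub>?M\<^esub> y \<in> carrier ?M" if "x \<in> carrier ?M" "y \<in> carrier ?M" for x y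
    unfolding add by (intro closed a_closed coord that)
  have smult_closed: "r \<odot>\<^bsub>?M\<^esub> y \<in> carrier ?M" if "r \<in> carrier R" "y \<in> carrier ?M" for r y
    unfolding smult by (intro closed m_closed coord that)
  have zero_closed: "\<zero>\<^bsub>?M\<^esub> \<in> carrier ?M"
    unfolding zero by (intro closed) simp
  note cl = add_closed smult_closed zero_closed
  have "abelian_group ?M"
  proof (rule abelian_groupI)
    fix x y z assume x: "x \<in> carrier ?M" and y: "y \<in> carrier ?M" and z: "z \<in> carrier ?M"
    show "x \<oplus>\<^bsub>?M\<^esub> y \<oplus>\<^bsub>?M\<^esub> z = x \<oplus>\<^bsub>?M\<^esub> (y \<oplus>\<^bsub>?M\<^esub> z)"
      by (rule eqI[OF cl(1)[OF cl(1)[OF x y] z] cl(1)[OF x cl(1)[OF y z]]])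
        (simp add: add a_assoc coord[OF x] coord[OF y] coord[OF z] del: One_nat_def)
  next
    fix x y assume x: "x \<in> carrier ?M" and y: "y \<in> carrier ?M"
    show "x \<oplus>\<^bsub>?M\<^esub> y = y \<oplus>\<^bsub>?M\<^esub> x"
      by (rule eqI[OF cl(1)[OF x y] cl(1)[OF y x]])
        (simp add: add a_comm[OF coord[OF x] coord[OF y]] del: One_nat_def)
  next
    fix x assume x: "x \<in> carrier ?M"
    show "\<zero>\<^bsub>?M\<^esub> \<oplus>\<^bsub>?M\<^esub> x = x"
      by (rule eqI[OF cl(1)[OF cl(3) x] x]) (simp add: add zero coord[OF x] del: One_nat_def)
    have neg: "(\<lambda>l\<in>{1..n}. \<ominus> x l) \<in> carrier ?M"
      by (intro closed a_inv_closed coord x)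
    have "(\<lambda>l\<in>{1..n}. \<ominus> x l) \<oplus>\<^bsub>?M\<^esub> x = \<zero>\<^bsub>?M\<^esub>"
      by (rule eqI[OF cl(1)[OF neg x] cl(3)])
        (simp add: add zero l_neg coord[OF x] del: One_nat_def)
    with neg show "\<exists>y\<in>carrier ?M. y \<oplus>\<^bsub>?M\<^esub> x = \<zero>\<^bsub>?M\<^esub>" by blast
  qed (rule cl; assumption)+
  then show ?thesis
  proof (rule moduleI[OF is_cring])
    fix r s x assume r: "r \<in> carrier R" and s: "s \<in> carrier R" and x: "x \<in> carrier ?M"
    show "(r \<oplus> s) \<odot>\<^bsub>?M\<^esub> x = r \<odot>\<^bsub>?M\<^esub> x \<oplus>\<^bsub>?M\<^esub> s \<odot>\<^bsub>?M\<^esub> x"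
      by (rule eqI[OF cl(2)[OF a_closed[OF r s] x] cl(1)[OF cl(2)[OF r x] cl(2)[OF s x]]])
        (simp add: add smult l_distr r s coord[OF x] del: One_nat_def)
    show "(r \<otimes> s) \<odot>\<^bsub>?M\<^esub> x = r \<odot>\<^bsub>?M\<^esub> (s \<odot>\<^bsub>?M\<^esub> x)"
      by (rule eqI[OF cl(2)[OF m_closed[OF r s] x] cl(2)[OF r cl(2)[OF s x]]])
        (simp add: smult m_assoc r s coord[OF x] del: One_nat_def)
  next
    fix r x y assume r: "r \<in> carrier R" and x: "x \<in> carrier ?M" and y: "y \<in> carrier ?M"
    show "r \<odot>\<^bsub>?M\<^esub> (x \<oplus>\<^bsub>?M\<^esub> y) = r \<odot>\<^bsub>?M\<^esub> x \<oplus>\<^bsub>?M\<^esub> r \<odot>\<^bsub>?M\<^esub> y"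
      by (rule eqI[OF cl(2)[OF r cl(1)[OF x y]] cl(1)[OF cl(2)[OF r x] cl(2)[OF r y]]])
        (simp add: add smult r_distr r coord[OF x] coord[OF y] del: One_nat_def)
  next
    fix x assume x: "x \<in> carrier ?M"
    show "\<one> \<odot>\<^bsub>?M\<^esub> x = x"
      by (rule eqI[OF cl(2)[OF one_closed x] x]) (simp add: smult coord[OF x] del: One_nat_def)
  qed (rule cl; assumption)+
qed

definition linear_code :: "('r, 'm) ring_scheme \<Rightarrow> nat \<Rightarrow> (nat \<Rightarrow> 'r) set \<Rightarrow> bool" where
  "linear_code R n C \<longleftrightarrow> submodule C R (power_module R n)"

definition dual_code :: "('r, 'm) ring_scheme \<Rightarrow> nat \<Rightarrow> (nat \<Rightarrow> 'r) set \<Rightarrow> (nat \<Rightarrow> 'r) set" where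
  "dual_code R n C =
    {v \<in> carrier (power_module R n). \<forall>u\<in>C. (\<Oplus>\<^bsub>R\<^esub>l\<in>{1..n}. u l \<otimes>\<^bsub>R\<^esub> v l) = \<zero>\<^bsub>R\<^esub>}"


text \<open>The internal sum \<open>b\<^sub>1R + \<dots> + b\<^sub>kR\<close>.\<close>

definition ideal_sum :: "('r, 'm) ring_scheme \<Rightarrow> nat \<Rightarrow> (nat \<Rightarrow> 'r) \<Rightarrow> 'r set" where
  "ideal_sum R k b = {\<Oplus>\<^bsub>R\<^esub>m\<in>{1..k}. x m | x. x \<in> (\<Pi> m\<in>{1..k}. PIdl\<^bsub>R\<^esub> (b m))}"

definition tuple_support ::
    "('r, 'm) ring_scheme \<Rightarrow> nat \<Rightarrow> (nat \<Rightarrow> 'r) \<Rightarrow> nat \<Rightarrow> nat \<Rightarrow> (nat \<Rightarrow> nat \<Rightarrow> 'r) \<Rightarrow> nat set" where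
  "tuple_support R n a k i c = {l \<in> {1..n}. ideal_sum R k (\<lambda>m. c m l) = PIdl\<^bsub>R\<^esub> (a i)}"

definition mult_level :: "nat \<Rightarrow> nat \<Rightarrow> nat multiset \<Rightarrow> nat set" where
  "mult_level n i Z = {l \<in> {1..n}. count Z l = i}"

definition support_count ::
    "('r, 'm) ring_scheme \<Rightarrow> nat \<Rightarrow> nat \<Rightarrow> (nat \<Rightarrow> 'r) \<Rightarrow> nat \<Rightarrow> (nat \<Rightarrow> 'r) set \<Rightarrow> nat multiset \<Rightarrow> nat" where
  "support_count R n t a k C Z =
    card {c \<in> {1..k} \<rightarrow>\<^sub>E C. \<forall>i\<le>t. tuple_support R n a k i c = mult_level n i Z}"


text \<open>Polynomials in indeterminates of type \<open>'v\<close>: finitely supported functions from monomials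
  (exponent vectors) to coefficients, multiplied by convolution.\<close>

type_synonym ('v, 'a) mpoly = "('v \<Rightarrow>\<^sub>0 nat) \<Rightarrow>\<^sub>0 'a"

definition pvar :: "'v \<Rightarrow> ('v, 'a::comm_semiring_1) mpoly" where
  "pvar v = Poly_Mapping.single (Poly_Mapping.single v 1) 1"

definition pconst :: "'a \<Rightarrow> ('v, 'a::comm_semiring_1) mpoly" where
  "pconst c = Poly_Mapping.single 0 c"

definition psubst ::
    "('v \<Rightarrow> ('w, 'a::comm_semiring_1) mpoly) \<Rightarrow> ('v, 'a) mpoly \<Rightarrow> ('w, 'a) mpoly" where
  "psubst s p = (\<Sum>m\<in>Poly_Mapping.keys p.
     pconst (Poly_Mapping.lookup p m) *
     (\<Prod>v\<in>Poly_Mapping.keys m. s v ^ Poly_Mapping.lookup m v))"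

text \<open>The indeterminate \<open>x\<^sub>i\<^sub>l\<close> is \<open>pvar (i, l)\<close>.\<close>

definition sse ::
    "('r, 'm) ring_scheme \<Rightarrow> nat \<Rightarrow> nat \<Rightarrow> (nat \<Rightarrow> 'r) \<Rightarrow> nat \<Rightarrow> (nat \<Rightarrow> 'r) set \<Rightarrow>
     (nat \<times> nat, rat) mpoly" where
  "sse R n t a k C =
    (\<Sum>Z | Z \<subseteq># repeat_mset t (mset_set {1..n}).
       of_nat (support_count R n t a k C Z) *
       (\<Prod>i\<in>{0..t}. \<Prod>l\<in>mult_level n i Z. pvar (i, l)))"

text \<open>The set of multisets indexing the sum is finite, so the sum is not a default value.\<close>

lemma finite_submultisets: "finite {Z. Z \<subseteq># (M :: 'a multiset)}"
proof (induction M)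
  case (add x M)
  have "{Z. Z \<subseteq># add_mset x M} \<subseteq> {Z. Z \<subseteq># M} \<union> add_mset x ` {Z. Z \<subseteq># M}"
  proof
    fix Z assume "Z \<in> {Z. Z \<subseteq># add_mset x M}"
    then have Z: "Z \<subseteq># add_mset x M" by simp
    show "Z \<in> {Z. Z \<subseteq># M} \<union> add_mset x ` {Z. Z \<subseteq># M}"
    proof (cases "x \<in># Z")
      case True
      then obtain Y where "Z = add_mset x Y" by (metis insert_DiffM)
      with Z show ?thesis by auto
    next
      case False
      with Z have "Z \<subseteq># M"
        by (metis diff_single_trivial subset_eq_diff_conv
            add_mset_add_single)
      then show ?thesis by simp
    qed
  qed
  with add.IH show ?case by (meson finite_UnI finite_imageI finite_subset)
qed simp

text \<open>Replace \<open>x\<^sub>i\<^sub>l\<close> by the \<open>(i, l)\<close> entry of \<open>M X\<close>.\<close>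

definition psubst_matrix ::
    "nat \<Rightarrow> rat mat \<Rightarrow> (nat \<times> nat, rat) mpoly \<Rightarrow> (nat \<times> nat, rat) mpoly" where
  "psubst_matrix t M =
    psubst (\<lambda>(i, l). \<Sum>j\<in>{0..t}. pconst (M $$ (i, j)) * pvar (j, l))"


definition A_mat :: "('r, 'm) ring_scheme \<Rightarrow> nat \<Rightarrow> (nat \<Rightarrow> 'r) \<Rightarrow> rat mat" where
  "A_mat R t a = mat (t + 1) (t + 1)
    (\<lambda>(i, j). if PIdl\<^bsub>R\<^esub> (a i) \<subseteq> PIdl\<^bsub>R\<^esub> (a j) then 1 else 0)"

definition D_mat :: "('r, 'm) ring_scheme \<Rightarrow> nat \<Rightarrow> (nat \<Rightarrow> 'r) \<Rightarrow> rat mat" where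
  "D_mat R t a = mat_diag (t + 1) (\<lambda>i. of_nat (card (PIdl\<^bsub>R\<^esub> (a i))))"

definition Q_mat :: "('r, 'm) ring_scheme \<Rightarrow> nat \<Rightarrow> (nat \<Rightarrow> 'r) \<Rightarrow> rat mat" where
  "Q_mat R t a = mat (t + 1) (t + 1)
    (\<lambda>(i, j). if PIdl\<^bsub>R\<^esub> (a j) \<subseteq> annihilator R (a i) then 1 else 0)"

text \<open>\<open>mat_inverse\<close> returns \<open>None\<close> exactly for singular matrices; the matrix \<open>A\<close> is invertible.\<close>

definition QDA_mat :: "('r, 'm) ring_scheme \<Rightarrow> nat \<Rightarrow> (nat \<Rightarrow> 'r) \<Rightarrow> nat \<Rightarrow> rat mat" where
  "QDA_mat R t a k = Q_mat R t a * D_mat R t a ^\<^sub>m k * the (mat_inverse (A_mat R t a))"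

end

(* If C = C' + xR, then |C'||C'^perp| <= |C||C^perp|, since v -> x.v maps C'^perp with kernel
   C^perp into the annihilator of {r : rx in C'}, and |I||ann I| = |R| for every (principal) ideal I.
   The values at 0 and at R^n are both |R|^n, so |C||C^perp| = |R|^n for all C. Applied to C + J with
   J a product of ideals, this counts the words of C^perp whose l-th coordinate lies in a prescribed
   ideal, for every l. Writing X = AY turns the coefficients of the enumerators into the k-th powers
   of such counts, and the identity holds coefficient by coefficient.

   For the matrices, let P be the permutation matrix of the involution I -> ann I of the ideals.
   Then Q = AP and D^k P D^k = |R|^k P, so (Q D^k A^-1)^2 = A P (D^k P D^k) A^-1 = |R|^k I. *)

theory Submission
  imports Defs "Jordan_Normal_Form.Determinant"
begin

subsection \<open>Counting in finite abelian groups\<close>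

text \<open>Two obstacles shape the argument. When a word x is adjoined to a code, it is not visible
  that v -> x.v maps the dual onto the whole annihilator; only its containment there is clear. So
  each step gives an inequality, and equality appears only because the two ends of the chain agree.
  The enumerator asks for exact equalities c_1l R + ... + c_kl R = a_i R, which do not split over
  the k words. An inclusion of this sum in an ideal J does split: every c_ml must lie in J. The
  matrix A encodes the passage from equalities to inclusions: x_il is the sum of y_jl over all j
  with a_i R inside a_j R. Expanding the product over the coordinates then chooses one ideal J_l per
  coordinate, and the coefficient counts k-tuples of words in the product of the J_l. For J_l = c_l
  R, the number of words of the dual in this product is 1/|C| times the product of the |c_l R| times
  the number of words of C with l-th entry in ann(c_l). The k-th power of this identity is the
  origin of 1/|C|^k and of D^k; the annihilators in it are the origin of Q.\<close>

lemma (in abelian_group) minus_eq_zero_iff: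
  assumes "x \<in> carrier G" "y \<in> carrier G"
  shows "x \<ominus> y = \<zero> \<longleftrightarrow> x = y"
  using assms by (metis a_minus_def add.inv_solve_right l_zero r_neg zero_closed)

text \<open>Lagrange's theorem with the quotient replaced by a map: the hypothesis on
  \<open>f\<close> says that its fibers are the cosets of \<open>K\<close>. The target of
  \<open>f\<close> carries no group structure, so \<open>f\<close> may be a homomorphism or a map to
  cosets alike.\<close>

lemma card_eq_fibers:
  fixes f :: "'a \<Rightarrow> 'b"
  assumes G: "abelian_group G" and S: "subgroup S (add_monoid G)" and fin: "finite S"
    and f: "\<And>x y. x \<in> S \<Longrightarrow> y \<in> S \<Longrightarrow> f x = f y \<longleftrightarrow> x \<ominus>\<^bsub>G\<^esub> y \<in> K"
    and K: "K \<subseteq> S"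
  shows "card S = card K * card (f ` S)"
proof -
  interpret G: abelian_group G by (rule G)
  have sub: "S \<subseteq> carrier G" using subgroup.subset[OF S] by simp
  have add: "x \<oplus>\<^bsub>G\<^esub> y \<in> S" if "x \<in> S" "y \<in> S" for x y
    using subgroup.m_closed[OF S that] by simp
  have minus: "x \<ominus>\<^bsub>G\<^esub> y \<in> S" if "x \<in> S" "y \<in> S" for x y
    using add[OF that(1) subgroup.m_inv_closed[OF S that(2)]]
    by (simp add: a_minus_def a_inv_def)
  have fiber: "card {y \<in> S. f y = f x} = card K" if x: "x \<in> S" for x
  proof -
    have "{y \<in> S. f y = f x} = (\<lambda>z. z \<oplus>\<^bsub>G\<^esub> x) ` K"
    proof (intro equalityI subsetI)
      fix y assume "y \<in> {y \<in> S. f y = f x}"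
      then have y: "y \<in> S" "y \<ominus>\<^bsub>G\<^esub> x \<in> K" using f x by auto
      have "y = (y \<ominus>\<^bsub>G\<^esub> x) \<oplus>\<^bsub>G\<^esub> x"
        using x y sub by (simp add: subset_eq a_minus_def G.a_assoc G.l_neg)
      with y show "y \<in> (\<lambda>z. z \<oplus>\<^bsub>G\<^esub> x) ` K" by blast
    next
      fix y assume "y \<in> (\<lambda>z. z \<oplus>\<^bsub>G\<^esub> x) ` K"
      then obtain z where z: "z \<in> K" "y = z \<oplus>\<^bsub>G\<^esub> x" by blast
      have "(z \<oplus>\<^bsub>G\<^esub> x) \<ominus>\<^bsub>G\<^esub> x = z"
        using x z K sub by (simp add: subset_eq a_minus_def G.a_assoc G.r_neg)
      with z x K add f show "y \<in> {y \<in> S. f y = f x}" by auto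
    qed
    moreover have "inj_on (\<lambda>z. z \<oplus>\<^bsub>G\<^esub> x) K"
      using x K sub by (intro inj_onI) (metis G.add.right_cancel subsetD)
    ultimately show ?thesis by (simp add: card_image)
  qed
  have "card S = (\<Sum>b\<in>f ` S. card {y \<in> S. f y = b})"
    using sum.image_gen[OF fin, of "\<lambda>_. 1::nat" f] by simp
  also have "\<dots> = (\<Sum>b\<in>f ` S. card K)"
    by (rule sum.cong) (auto simp: fiber)
  finally show ?thesis by simp
qed

text \<open>Counting form of the second isomorphism theorem: A/(A \<inter> B) and (A + B)/B have the
  same cosets.\<close>

lemma card_subgroup_sum:
  assumes G: "abelian_group G" and fin: "finite (carrier G)"
    and A: "subgroup A (add_monoid G)" and B: "subgroup B (add_monoid G)"
  shows "card (A <+>\<^bsub>G\<^esub> B) * card (A \<inter> B) = card A * card B"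
proof -
  interpret G: abelian_group G by (rule G)
  define S where "S = A <+>\<^bsub>G\<^esub> B"
  have S_eq: "S = {x \<oplus>\<^bsub>G\<^esub> y | x y. x \<in> A \<and> y \<in> B}"
    by (auto simp: S_def set_add_def')
  have S: "subgroup S (add_monoid G)"
    using G.add_additive_subgroups A B by (simp add: S_def additive_subgroup_def)
  have sub: "A \<subseteq> carrier G" "B \<subseteq> carrier G" "S \<subseteq> carrier G"
    using A B S subgroup.subset by fastforce+
  have finA: "finite A" and finS: "finite S"
    using sub fin finite_subset by blast+
  have zero: "\<zero>\<^bsub>G\<^esub> \<in> A" "\<zero>\<^bsub>G\<^esub> \<in> B"
    using A B subgroup.one_closed by fastforce+
  have addB: "x \<oplus>\<^bsub>G\<^esub> y \<in> B" if "x \<in> B" "y \<in> B" for x y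
    using subgroup.m_closed[OF B that] by simp
  have negB: "\<ominus>\<^bsub>G\<^esub> y \<in> B" if "y \<in> B" for y
    using subgroup.m_inv_closed[OF B that] by (simp add: a_inv_def)
  have minusA: "x \<ominus>\<^bsub>G\<^esub> y \<in> A" if "x \<in> A" "y \<in> A" for x y
    using subgroup.m_closed[OF A that(1) subgroup.m_inv_closed[OF A that(2)]]
    by (simp add: a_minus_def a_inv_def)
  have AS: "A \<subseteq> S"
  proof
    fix x assume "x \<in> A"
    then have "x = x \<oplus>\<^bsub>G\<^esub> \<zero>\<^bsub>G\<^esub>" using sub by auto
    with \<open>x \<in> A\<close> zero show "x \<in> S" unfolding S_eq by blast
  qed
  have BS: "B \<subseteq> S"
  proof
    fix x assume "x \<in> B"
    then have "x = \<zero>\<^bsub>G\<^esub> \<oplus>\<^bsub>G\<^esub> x" using sub by auto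
    with \<open>x \<in> B\<close> zero show "x \<in> S" unfolding S_eq by blast
  qed
  \<comment> \<open>The coset of \<open>B\<close> that contains \<open>x\<close>, so that the
    quotient by \<open>B\<close> is a plain set of sets.\<close>
  define q where "q x = {z \<in> carrier G. z \<ominus>\<^bsub>G\<^esub> x \<in> B}" for x
  have q: "q x = q y \<longleftrightarrow> x \<ominus>\<^bsub>G\<^esub> y \<in> B" if x: "x \<in> carrier G" and y: "y \<in> carrier G" for x y
  proof
    assume "q x = q y"
    moreover have "x \<in> q x" using x zero by (simp add: q_def a_minus_def G.r_neg)
    ultimately show "x \<ominus>\<^bsub>G\<^esub> y \<in> B" by (simp add: q_def)
  next
    assume d: "x \<ominus>\<^bsub>G\<^esub> y \<in> B"
    have d': "y \<ominus>\<^bsub>G\<^esub> x \<in> B"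
      using negB[OF d] x y by (simp add: a_minus_def G.minus_add G.a_comm)
    have split: "z \<ominus>\<^bsub>G\<^esub> w = (z \<ominus>\<^bsub>G\<^esub> v) \<oplus>\<^bsub>G\<^esub> (v \<ominus>\<^bsub>G\<^esub> w)"
      if "v \<in> carrier G" "w \<in> carrier G" "z \<in> carrier G" for v w z
      using that by (simp add: a_minus_def G.a_assoc G.r_neg1)
    have "z \<ominus>\<^bsub>G\<^esub> x \<in> B \<longleftrightarrow> z \<ominus>\<^bsub>G\<^esub> y \<in> B" if z: "z \<in> carrier G" for z
      using addB[OF _ d] addB[OF _ d'] split[of x y z] split[of y x z] x y z by metis
    then show "q x = q y" by (auto simp: q_def)
  qed
  have "card A = card (A \<inter> B) * card (q ` A)"
    using q[OF subsetD[OF sub(1)] subsetD[OF sub(1)]] minusA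
    by (intro card_eq_fibers[OF G A finA]) auto
  moreover have "card S = card B * card (q ` S)"
    by (rule card_eq_fibers[OF G S finS _ BS]) (rule q[OF subsetD[OF sub(3)] subsetD[OF sub(3)]])
  \<comment> \<open>Every coset of \<open>B\<close> in A + B has a representative in
    \<open>A\<close>; the two fiber counts therefore share a factor.\<close>
  moreover have "q ` S = q ` A"
  proof
    show "q ` S \<subseteq> q ` A"
    proof
      fix c assume "c \<in> q ` S"
      then obtain x y where xy: "x \<in> A" "y \<in> B" "c = q (x \<oplus>\<^bsub>G\<^esub> y)" unfolding S_eq by blast
      have "(x \<oplus>\<^bsub>G\<^esub> y) \<ominus>\<^bsub>G\<^esub> x = y"
        using xy sub by (simp add: subset_eq G.a_comm[of x y] a_minus_def G.a_assoc G.r_neg)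
      then have "q (x \<oplus>\<^bsub>G\<^esub> y) = q x" using xy sub by (subst q) auto
      then show "c \<in> q ` A" using xy by auto
    qed
  qed (use AS in auto)
  ultimately show ?thesis by (simp add: S_def)
qed

subsection \<open>Annihilators\<close>

context finite_principal_ring
begin

lemma mem_PIdl_iff: "x \<in> PIdl c \<longleftrightarrow> (\<exists>r\<in>carrier R. x = r \<otimes> c)"
  by (auto simp: cgenideal_def)

lemma PIdl_subset_iff:
  assumes "c \<in> carrier R" "ideal I R"
  shows "PIdl c \<subseteq> I \<longleftrightarrow> c \<in> I"
  using assms cgenideal_minimal cgenideal_self by blast

lemma ideal_annihilator: "ideal (annihilator R c) R" if c: "c \<in> carrier R" for c
proof (rule idealI[OF ring_axioms])
  show "subgroup (annihilator R c) (add_monoid R)"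
    by (rule add.subgroupI) (use c in \<open>auto simp: annihilator_def r_distr r_minus intro: exI[of _ \<zero>]\<close>)
next
  fix b x assume "b \<in> annihilator R c" "x \<in> carrier R"
  then show "b \<otimes> x \<in> annihilator R c" "x \<otimes> b \<in> annihilator R c"
    using c by (auto simp: annihilator_def m_assoc m_comm[of b x] m_lcomm[of c x b])
qed

text \<open>Multiplication by \<open>c\<close> on R has image cR and kernel ann(c).\<close>

lemma card_PIdl_annihilator:
  assumes c: "c \<in> carrier R"
  shows "card (carrier R) = card (annihilator R c) * card (PIdl c)"
proof -
  have "(\<lambda>r. c \<otimes> r) ` carrier R = PIdl c"
    using c by (auto simp: mem_PIdl_iff m_comm)
  moreover have "c \<otimes> x = c \<otimes> y \<longleftrightarrow> x \<ominus> y \<in> annihilator R c"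
    if "x \<in> carrier R" "y \<in> carrier R" for x y
  proof -
    have "c \<otimes> (x \<ominus> y) = c \<otimes> x \<ominus> c \<otimes> y"
      using c that by (simp add: a_minus_def r_distr r_minus)
    then show ?thesis using c that minus_eq_zero_iff[of "c \<otimes> x" "c \<otimes> y"] by (simp add: annihilator_def)
  qed
  ultimately show ?thesis
    using card_eq_fibers[OF is_abelian_group _ finite_carrier, of "\<lambda>r. c \<otimes> r" "annihilator R c"]
    by (simp add: annihilator_def add.subgroup_self)
qed

text \<open>The double annihilator property: equality follows from an inclusion by counting, because
  \<open>ann(c)\<close> is itself principal.\<close>

lemma annihilator_generator:
  assumes c: "c \<in> carrier R" and d: "d \<in> carrier R" and eq: "annihilator R c = PIdl d"
  shows "annihilator R d = PIdl c"
proof (rule card_subset_eq[symmetric])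
  show "finite (annihilator R d)"
    using finite_carrier by (simp add: annihilator_def)
  have "c \<in> annihilator R d"
    using cgenideal_self[OF d] c d unfolding eq[symmetric] by (simp add: annihilator_def m_comm)
  then show "PIdl c \<subseteq> annihilator R d"
    by (simp add: PIdl_subset_iff c d ideal_annihilator)
  have "card (carrier R) \<noteq> 0"
    using finite_carrier by auto
  then show "card (PIdl c) = card (annihilator R d)"
    using card_PIdl_annihilator[OF c] card_PIdl_annihilator[OF d] eq
    by (metis mult.commute mult_cancel_left mult_is_0)
qed

end

subsection \<open>Dual codes\<close>

locale code_space = finite_principal_ring +
  fixes n :: nat

sublocale code_space \<subseteq> V: module R "power_module R n"
  by (rule module_power_module)

context code_space
begin

section \<open>The bilinear form on R^n\<close>

abbreviation V where "V \<equiv> power_module R n"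

definition dot :: "(nat \<Rightarrow> 'a) \<Rightarrow> (nat \<Rightarrow> 'a) \<Rightarrow> 'a" where
  "dot u v = (\<Oplus>l\<in>{1..n}. u l \<otimes> v l)"

lemma carrier_V: "carrier V = {1..n} \<rightarrow>\<^sub>E carrier R"
  by (simp add: power_module_def)

lemma finite_carrier_V: "finite (carrier V)"
  by (simp add: carrier_V finite_PiE finite_carrier)

lemma coord_closed [simp]: "v \<in> carrier V \<Longrightarrow> 1 \<le> l \<Longrightarrow> l \<le> n \<Longrightarrow> v l \<in> carrier R"
  by (auto simp: carrier_V PiE_iff)

lemma coord_simps [simp]:
  assumes "1 \<le> l" "l \<le> n"
  shows "(u \<oplus>\<^bsub>V\<^esub> v) l = u l \<oplus> v l" "(r \<odot>\<^bsub>V\<^esub> v) l = r \<otimes> v l" "\<zero>\<^bsub>V\<^esub> l = \<zero>"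
  using assms by (simp_all add: power_module_def)

lemma dot_closed [simp]: "u \<in> carrier V \<Longrightarrow> v \<in> carrier V \<Longrightarrow> dot u v \<in> carrier R"
  unfolding dot_def by (intro finsum_closed) auto

lemma dot_commute: "u \<in> carrier V \<Longrightarrow> v \<in> carrier V \<Longrightarrow> dot u v = dot v u"
  unfolding dot_def by (intro finsum_cong') (auto simp: m_comm)

lemma dot_add:
  assumes "u \<in> carrier V" "v \<in> carrier V" "w \<in> carrier V"
  shows "dot u (v \<oplus>\<^bsub>V\<^esub> w) = dot u v \<oplus> dot u w"
proof -
  have "dot u (v \<oplus>\<^bsub>V\<^esub> w) = (\<Oplus>l\<in>{1..n}. u l \<otimes> v l \<oplus> u l \<otimes> w l)"
    unfolding dot_def using assms by (intro finsum_cong') (auto simp: r_distr)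
  then show ?thesis
    unfolding dot_def using assms by (subst (asm) finsum_addf) auto
qed

lemma dot_smult:
  assumes "u \<in> carrier V" "v \<in> carrier V" "r \<in> carrier R"
  shows "dot u (r \<odot>\<^bsub>V\<^esub> v) = r \<otimes> dot u v"
proof -
  have "dot u (r \<odot>\<^bsub>V\<^esub> v) = (\<Oplus>l\<in>{1..n}. r \<otimes> (u l \<otimes> v l))"
    unfolding dot_def using assms by (intro finsum_cong') (auto simp: m_lcomm)
  then show ?thesis
    unfolding dot_def using assms by (subst finsum_rdistr) auto
qed

lemma dot_add_left:
  assumes "u \<in> carrier V" "v \<in> carrier V" "w \<in> carrier V"
  shows "dot (u \<oplus>\<^bsub>V\<^esub> v) w = dot u w \<oplus> dot v w"
  using assms by (metis V.a_closed dot_add dot_commute)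

lemma dot_smult_left:
  assumes "u \<in> carrier V" "v \<in> carrier V" "r \<in> carrier R"
  shows "dot (r \<odot>\<^bsub>V\<^esub> u) v = r \<otimes> dot u v"
  using assms by (metis V.smult_closed dot_smult dot_commute)

lemma dot_zero: "u \<in> carrier V \<Longrightarrow> dot u \<zero>\<^bsub>V\<^esub> = \<zero>"
  using dot_smult[of u "\<zero>\<^bsub>V\<^esub>" \<zero>] by simp

lemma dot_minus:
  assumes "u \<in> carrier V" "v \<in> carrier V" "w \<in> carrier V"
  shows "dot u (v \<ominus>\<^bsub>V\<^esub> w) = dot u v \<ominus> dot u w"
proof -
  have "v \<ominus>\<^bsub>V\<^esub> w = v \<oplus>\<^bsub>V\<^esub> (\<ominus> \<one>) \<odot>\<^bsub>V\<^esub> w"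
    using assms by (simp add: V.smult_l_minus a_minus_def)
  then show ?thesis
    using assms by (simp add: dot_add dot_smult a_minus_def l_minus)
qed

lemma mem_dual_iff: "v \<in> dual_code R n C \<longleftrightarrow> v \<in> carrier V \<and> (\<forall>u\<in>C. dot u v = \<zero>)"
  by (simp add: dual_code_def dot_def)

section \<open>Submodules of R^n, their sums and their duals\<close>

lemma submodule_VI:
  assumes "H \<subseteq> carrier V" "\<zero>\<^bsub>V\<^esub> \<in> H"
    and "\<And>a b. a \<in> H \<Longrightarrow> b \<in> H \<Longrightarrow> a \<oplus>\<^bsub>V\<^esub> b \<in> H"
    and "\<And>a x. a \<in> carrier R \<Longrightarrow> x \<in> H \<Longrightarrow> a \<odot>\<^bsub>V\<^esub> x \<in> H"
  shows "submodule H R V"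
proof (rule V.submoduleI)
  fix a assume a: "a \<in> H"
  have "\<ominus>\<^bsub>V\<^esub> a = (\<ominus> \<one>) \<odot>\<^bsub>V\<^esub> a"
    using a assms(1) by (subst V.smult_l_minus) auto
  then show "\<ominus>\<^bsub>V\<^esub> a \<in> H" using assms(4) a by simp
qed (use assms in auto)

lemma submodule_subset: "submodule H R V \<Longrightarrow> H \<subseteq> carrier V"
  by (rule V.submoduleE(1))

lemma submodule_subgroup: "submodule H R V \<Longrightarrow> subgroup H (add_monoid V)"
  by (rule submodule.axioms(1))

lemma submodule_zero: "submodule H R V \<Longrightarrow> \<zero>\<^bsub>V\<^esub> \<in> H"
  using subgroup.one_closed[OF submodule_subgroup] by fastforce

lemma submodule_finite: "submodule H R V \<Longrightarrow> finite H"
  using submodule_subset finite_carrier_V finite_subset by blast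

lemma submodule_dual:
  assumes "C \<subseteq> carrier V"
  shows "submodule (dual_code R n C) R V"
  using assms by (intro submodule_VI) (auto simp: mem_dual_iff dot_zero dot_add dot_smult subset_eq)

lemma submodule_set_add:
  assumes "submodule A R V" "submodule B R V"
  shows "submodule (A <+>\<^bsub>V\<^esub> B) R V"
proof -
  have "additive_subgroup (A <+>\<^bsub>V\<^esub> B) V"
    using assms by (intro V.add_additive_subgroups additive_subgroupI submodule_subgroup)
  then have sub: "subgroup (A <+>\<^bsub>V\<^esub> B) (add_monoid V)"
    by (simp add: additive_subgroup_def)
  show ?thesis
  proof (intro submodule.intro sub submodule_axioms.intro)
    fix r x assume r: "r \<in> carrier R" and "x \<in> A <+>\<^bsub>V\<^esub> B"
    then obtain y z where x: "y \<in> A" "z \<in> B" "x = y \<oplus>\<^bsub>V\<^esub> z"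
      by (auto simp: set_add_def')
    then have "r \<odot>\<^bsub>V\<^esub> x = r \<odot>\<^bsub>V\<^esub> y \<oplus>\<^bsub>V\<^esub> r \<odot>\<^bsub>V\<^esub> z"
      using r assms[THEN submodule_subset] by (simp add: subset_eq V.smult_r_distr)
    then show "r \<odot>\<^bsub>V\<^esub> x \<in> A <+>\<^bsub>V\<^esub> B"
      using submodule.smult_closed[OF assms(1) r x(1)] submodule.smult_closed[OF assms(2) r x(2)]
      by (auto simp: set_add_def')
  qed
qed

lemma set_add_subset:
  assumes "submodule A R V" "submodule B R V"
  shows "A \<subseteq> A <+>\<^bsub>V\<^esub> B" "B \<subseteq> A <+>\<^bsub>V\<^esub> B"
proof -
  show "A \<subseteq> A <+>\<^bsub>V\<^esub> B"
  proof
    fix x assume x: "x \<in> A"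
    then have "x = x \<oplus>\<^bsub>V\<^esub> \<zero>\<^bsub>V\<^esub>" using submodule_subset[OF assms(1)] by auto
    with x submodule_zero[OF assms(2)] show "x \<in> A <+>\<^bsub>V\<^esub> B" unfolding set_add_def' by blast
  qed
  show "B \<subseteq> A <+>\<^bsub>V\<^esub> B"
  proof
    fix x assume x: "x \<in> B"
    then have "x = \<zero>\<^bsub>V\<^esub> \<oplus>\<^bsub>V\<^esub> x" using submodule_subset[OF assms(2)] by auto
    with x submodule_zero[OF assms(1)] show "x \<in> A <+>\<^bsub>V\<^esub> B" unfolding set_add_def' by blast
  qed
qed

lemma dual_set_add:
  assumes "submodule A R V" "submodule B R V"
  shows "dual_code R n (A <+>\<^bsub>V\<^esub> B) = dual_code R n A \<inter> dual_code R n B"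
proof
  show "dual_code R n (A <+>\<^bsub>V\<^esub> B) \<subseteq> dual_code R n A \<inter> dual_code R n B"
    using set_add_subset[OF assms] unfolding mem_dual_iff subset_iff Int_iff by blast
  show "dual_code R n A \<inter> dual_code R n B \<subseteq> dual_code R n (A <+>\<^bsub>V\<^esub> B)"
    using assms[THEN submodule_subset]
    by (auto simp: mem_dual_iff set_add_def' subset_eq dot_add_left)
qed

section \<open>Adjoining one word to a code\<close>

definition span1 :: "(nat \<Rightarrow> 'a) \<Rightarrow> (nat \<Rightarrow> 'a) set" where
  "span1 x = (\<lambda>r. r \<odot>\<^bsub>V\<^esub> x) ` carrier R"

lemma submodule_span1:
  assumes "x \<in> carrier V"
  shows "submodule (span1 x) R V"
proof (rule submodule_VI)
  show "\<zero>\<^bsub>V\<^esub> \<in> span1 x"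
    using assms unfolding span1_def by (metis V.smult_l_null imageI zero_closed)
next
  fix a b assume "a \<in> span1 x" "b \<in> span1 x"
  then show "a \<oplus>\<^bsub>V\<^esub> b \<in> span1 x"
    unfolding span1_def using assms V.smult_l_distr[of _ _ x, symmetric] by auto
next
  fix r y assume "r \<in> carrier R" "y \<in> span1 x"
  then show "r \<odot>\<^bsub>V\<^esub> y \<in> span1 x"
    unfolding span1_def using assms V.smult_assoc1[of _ _ x, symmetric] by auto
qed (use assms in \<open>auto simp: span1_def\<close>)

lemma self_in_span1: "x \<in> carrier V \<Longrightarrow> x \<in> span1 x"
  unfolding span1_def by (metis V.smult_one imageI one_closed)

text \<open>\<open>I\<close> is the colon ideal (C : x), and r -> rx induces an isomorphism from R/I
  to (C + xR)/C.\<close>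

lemma card_set_add_span1:
  assumes C: "submodule C R V" and x: "x \<in> carrier V"
    and I: "I = {r \<in> carrier R. r \<odot>\<^bsub>V\<^esub> x \<in> C}"
  shows "ideal I R"
    and "card (span1 x <+>\<^bsub>V\<^esub> C) * card I = card (carrier R) * card C"
proof -
  note Csub = submodule_subset[OF C]
  interpret C: subgroup C "add_monoid V" by (rule submodule_subgroup[OF C])
  have add: "y \<oplus>\<^bsub>V\<^esub> z \<in> C" if "y \<in> C" "z \<in> C" for y z
    using C.m_closed that by simp
  have neg: "\<ominus>\<^bsub>V\<^esub> y \<in> C" if "y \<in> C" for y
    using C.m_inv_closed that by (simp add: a_inv_def)
  show ideal: "ideal I R"
  proof (rule idealI[OF ring_axioms])
    show "subgroup I (add_monoid R)"
    proof (rule add.subgroupI)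
      show "I \<noteq> {}" using x submodule_zero[OF C] by (auto simp: I intro: exI[of _ \<zero>])
    qed (use x add neg in \<open>auto simp: I V.smult_l_distr V.smult_l_minus\<close>)
  next
    fix r s assume rs: "r \<in> I" "s \<in> carrier R"
    then have "(s \<otimes> r) \<odot>\<^bsub>V\<^esub> x \<in> C"
      using x C submodule.smult_closed by (fastforce simp: I V.smult_assoc1)
    then show "s \<otimes> r \<in> I" "r \<otimes> s \<in> I" using rs by (auto simp: I m_comm)
  qed
  \<comment> \<open>The annihilator of \<open>x\<close>. It is the common kernel of r -> rx on R and
    on \<open>I\<close>, so it drops out when the two counts are combined.\<close>
  define K where "K = {r \<in> carrier R. r \<odot>\<^bsub>V\<^esub> x = \<zero>\<^bsub>V\<^esub>}"
  have KI: "K \<subseteq> I" using submodule_zero[OF C] by (auto simp: K_def I)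
  have Isub: "subgroup I (add_monoid R)"
    using ideal by (simp add: additive_subgroup.a_subgroup ideal.axioms(1))
  have fib: "r \<odot>\<^bsub>V\<^esub> x = s \<odot>\<^bsub>V\<^esub> x \<longleftrightarrow> r \<ominus> s \<in> K" if "r \<in> carrier R" "s \<in> carrier R" for r s
  proof -
    have "(r \<ominus> s) \<odot>\<^bsub>V\<^esub> x = r \<odot>\<^bsub>V\<^esub> x \<ominus>\<^bsub>V\<^esub> s \<odot>\<^bsub>V\<^esub> x"
      using that x by (simp add: a_minus_def V.smult_l_distr V.smult_l_minus)
    then show ?thesis
      using that x V.minus_eq_zero_iff[of "r \<odot>\<^bsub>V\<^esub> x" "s \<odot>\<^bsub>V\<^esub> x"] by (simp add: K_def)
  qed
  have "card (carrier R) = card K * card (span1 x)"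
    unfolding span1_def
    using fib by (intro card_eq_fibers[OF is_abelian_group add.subgroup_self finite_carrier])
      (auto simp: K_def)
  moreover have "card I = card K * card (span1 x \<inter> C)"
  proof -
    have "finite I" using finite_carrier by (simp add: I)
    moreover have "(\<lambda>r. r \<odot>\<^bsub>V\<^esub> x) ` I = span1 x \<inter> C" by (auto simp: I span1_def)
    ultimately show ?thesis
      using card_eq_fibers[OF is_abelian_group Isub, of "\<lambda>r. r \<odot>\<^bsub>V\<^esub> x" K] fib KI
      by (simp add: I)
  qed
  moreover have "card (span1 x <+>\<^bsub>V\<^esub> C) * card (span1 x \<inter> C) = card (span1 x) * card C"
    by (rule card_subgroup_sum[OF V.abelian_group_axioms finite_carrier_V])
      (use x C in \<open>auto intro: submodule_subgroup submodule_span1\<close>)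
  ultimately show "card (span1 x <+>\<^bsub>V\<^esub> C) * card I = card (carrier R) * card C"
    by (metis mult.assoc mult.commute)
qed

lemma card_dual_step:
  assumes C: "submodule C R V" and x: "x \<in> carrier V"
  shows "card C * card (dual_code R n C)
    \<le> card (span1 x <+>\<^bsub>V\<^esub> C) * card (dual_code R n (span1 x <+>\<^bsub>V\<^esub> C))"
proof -
  define I where "I = {r \<in> carrier R. r \<odot>\<^bsub>V\<^esub> x \<in> C}"
  note Csub = submodule_subset[OF C]
  have D: "submodule (dual_code R n C) R V" by (rule submodule_dual[OF Csub])
  \<comment> \<open>Principality of R enters here: a generator of \<open>I\<close> gives |I| |ann I|
    = |R|.\<close>
  from card_set_add_span1[OF C x I_def] obtain c where c: "c \<in> carrier R" "I = PIdl c"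
    and card: "card (span1 x <+>\<^bsub>V\<^esub> C) * card I = card (carrier R) * card C"
    using ideal_principal by blast
  have cI: "c \<in> I" using c cgenideal_self by simp
  have pos: "card I > 0" using cI finite_carrier by (auto simp: I_def card_gt_0_iff)
  let ?D' = "dual_code R n (span1 x <+>\<^bsub>V\<^esub> C)"
  have D': "?D' = {v \<in> dual_code R n C. dot x v = \<zero>}"
    using x self_in_span1[OF x]
    by (auto simp: dual_set_add submodule_span1 C mem_dual_iff) (auto simp: span1_def dot_smult_left)
  have "card (dual_code R n C) = card ?D' * card (dot x ` dual_code R n C)"
  proof (rule card_eq_fibers[OF V.abelian_group_axioms submodule_subgroup[OF D] submodule_finite[OF D]])
    fix u v assume uv: "u \<in> dual_code R n C" "v \<in> dual_code R n C"
    then have cl: "u \<in> carrier V" "v \<in> carrier V" by (auto simp: mem_dual_iff)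
    moreover have "u \<ominus>\<^bsub>V\<^esub> v \<in> dual_code R n C"
      using uv cl Csub by (auto simp: mem_dual_iff dot_minus subset_eq) (simp add: a_minus_def)
    ultimately show "dot x u = dot x v \<longleftrightarrow> u \<ominus>\<^bsub>V\<^esub> v \<in> ?D'"
      using x by (simp add: D' dot_minus minus_eq_zero_iff)
  qed (auto simp: D')
  \<comment> \<open>The only inequality of the proof: the image of \<open>dot x\<close> lies in
    ann(c), since c (x.v) = (cx).v and cx is a word of C.\<close>
  also have "\<dots> \<le> card ?D' * card (annihilator R c)"
  proof (intro mult_le_mono2 card_mono)
    show "finite (annihilator R c)" using finite_carrier by (simp add: annihilator_def)
    show "dot x ` dual_code R n C \<subseteq> annihilator R c"
    proof
      fix s assume "s \<in> dot x ` dual_code R n C"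
      then obtain v where v: "v \<in> carrier V" "\<forall>u\<in>C. dot u v = \<zero>" "s = dot x v"
        by (auto simp: mem_dual_iff)
      then have "c \<otimes> s = dot (c \<odot>\<^bsub>V\<^esub> x) v" using x c by (simp add: dot_smult_left)
      then show "s \<in> annihilator R c" using v x cI by (simp add: annihilator_def I_def)
    qed
  qed
  \<comment> \<open>The factor |I| turns |ann(c)| into |R|, and |R| |C| is then |C + xR| |I|, so
    that |I| cancels again.\<close>
  finally have "card C * card (dual_code R n C) * card I \<le> card C * card ?D' * card (carrier R)"
    using card_PIdl_annihilator[OF c(1)] c(2) by (simp add: mult_le_mono2 mult.assoc)
  also have "\<dots> = (card (span1 x <+>\<^bsub>V\<^esub> C) * card ?D') * card I"
    using card by (simp add: mult.commute mult.left_commute)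
  finally show ?thesis using pos by simp
qed

text \<open>Adjoining some x from B - A enlarges \<open>A\<close> strictly and stays inside
  \<open>B\<close>, so finitely many uses of \<open>card_dual_step\<close> lead from
  \<open>A\<close> to \<open>B\<close>.\<close>

lemma card_dual_mono:
  assumes A: "submodule A R V" and B: "submodule B R V" and sub: "A \<subseteq> B"
  shows "card A * card (dual_code R n A) \<le> card B * card (dual_code R n B)"
  using A sub
proof (induction "card B - card A" arbitrary: A rule: less_induct)
  case less
  note finB = submodule_finite[OF B]
  show ?case
  proof (cases "A = B")
    case False
    then obtain x where x: "x \<in> B" "x \<notin> A" using less.prems by blast
    then have xV: "x \<in> carrier V" using submodule_subset[OF B] by blast
    let ?A' = "span1 x <+>\<^bsub>V\<^esub> A"
    have S: "submodule (span1 x) R V" by (rule submodule_span1[OF xV])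
    have "x \<in> ?A'" using set_add_subset(1)[OF S less.prems(1)] self_in_span1[OF xV] by blast
    moreover have "A \<subseteq> ?A'" by (rule set_add_subset(2)[OF S less.prems(1)])
    ultimately have "A \<subset> ?A'" using x by blast
    moreover have A'B: "?A' \<subseteq> B"
      using x less.prems submodule.smult_closed[OF B] V.submoduleE(5)[OF B]
      by (auto simp: set_add_def' span1_def)
    ultimately have "card B - card ?A' < card B - card A"
      using finB by (meson card_mono diff_less_mono2 finite_subset le_less_trans less_le_trans psubset_card_mono)
    then have "card ?A' * card (dual_code R n ?A') \<le> card B * card (dual_code R n B)"
      using less.hyps submodule_set_add[OF S less.prems(1)] A'B by blast
    then show ?thesis using card_dual_step[OF less.prems(1) xV] by linarith
  qed simp
qed

section \<open>The two extreme codes and the size of a dual\<close>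

lemma submodule_carrier: "submodule (carrier V) R V"
  by (rule submodule_VI) auto

lemma submodule_zero_code: "submodule {\<zero>\<^bsub>V\<^esub>} R V"
  by (rule submodule_VI) auto

lemma vec_eqI:
  assumes "u \<in> carrier V" "v \<in> carrier V" "\<And>l. 1 \<le> l \<Longrightarrow> l \<le> n \<Longrightarrow> u l = v l"
  shows "u = v"
  using assms unfolding carrier_V by (intro PiE_ext) auto

definition unit_vec :: "nat \<Rightarrow> 'a \<Rightarrow> nat \<Rightarrow> 'a" where
  "unit_vec l b = (\<lambda>m\<in>{1..n}. if m = l then b else \<zero>)"

lemma unit_vec_closed: "b \<in> carrier R \<Longrightarrow> unit_vec l b \<in> carrier V"
  by (auto simp: unit_vec_def carrier_V)

lemma dot_unit_vec:
  assumes "l \<in> {1..n}" "b \<in> carrier R" "v \<in> carrier V"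
  shows "dot (unit_vec l b) v = b \<otimes> v l"
proof -
  have "dot (unit_vec l b) v = (\<Oplus>m\<in>{1..n}. if l = m then b \<otimes> v m else \<zero>)"
    unfolding dot_def unit_vec_def using assms by (intro finsum_cong') auto
  also have "\<dots> = b \<otimes> v l"
    using assms by (subst finsum_singleton) auto
  finally show ?thesis .
qed

lemma dual_carrier: "dual_code R n (carrier V) = {\<zero>\<^bsub>V\<^esub>}"
proof
  show "dual_code R n (carrier V) \<subseteq> {\<zero>\<^bsub>V\<^esub>}"
  proof
    fix v assume v: "v \<in> dual_code R n (carrier V)"
    then have vV: "v \<in> carrier V" by (simp add: mem_dual_iff)
    have "v l = \<zero>" if "1 \<le> l" "l \<le> n" for l
    proof -
      have "dot (unit_vec l \<one>) v = \<zero>"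
        using v unit_vec_closed[OF one_closed] by (auto simp: mem_dual_iff)
      then show ?thesis
        using dot_unit_vec[of l \<one> v] that vV by simp
    qed
    then have "v = \<zero>\<^bsub>V\<^esub>" using vV by (intro vec_eqI) auto
    then show "v \<in> {\<zero>\<^bsub>V\<^esub>}" by simp
  qed
qed (auto simp: mem_dual_iff dot_zero)

lemma dual_zero_code: "dual_code R n {\<zero>\<^bsub>V\<^esub>} = carrier V"
proof -
  have "dot \<zero>\<^bsub>V\<^esub> v = \<zero>" if "v \<in> carrier V" for v
    using that dot_zero dot_commute by simp
  then show ?thesis by (auto simp: mem_dual_iff)
qed

lemma card_dual:
  assumes "submodule C R V"
  shows "card C * card (dual_code R n C) = card (carrier R) ^ n"
proof -
  have V: "card (carrier V) = card (carrier R) ^ n"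
    by (simp add: carrier_V card_PiE)
  have "{\<zero>\<^bsub>V\<^esub>} \<subseteq> C" using submodule_zero[OF assms] by simp
  then show ?thesis
    using card_dual_mono[OF submodule_zero_code assms]
      card_dual_mono[OF assms submodule_carrier submodule_subset[OF assms]]
    by (simp add: dual_carrier dual_zero_code V)
qed

end

(* keeps {1..n} from being rewritten to {Suc 0..n} *)
declare One_nat_def [simp del]

context code_space
begin

section \<open>Products of ideals, regarded as codes\<close>

lemma submodule_PiE:
  assumes J: "\<And>l. l \<in> {1..n} \<Longrightarrow> ideal (J l) R"
  shows "submodule (Pi\<^sub>E {1..n} J) R V"
proof (rule submodule_VI)
  show "Pi\<^sub>E {1..n} J \<subseteq> carrier V"
    unfolding carrier_V by (intro PiE_mono subsetI) (rule ideal.Icarr[OF J])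
  show "\<zero>\<^bsub>V\<^esub> \<in> Pi\<^sub>E {1..n} J"
    using J by (auto simp: power_module_def additive_subgroup.zero_closed ideal.axioms(1))
next
  fix u v assume "u \<in> Pi\<^sub>E {1..n} J" "v \<in> Pi\<^sub>E {1..n} J"
  then show "u \<oplus>\<^bsub>V\<^esub> v \<in> Pi\<^sub>E {1..n} J"
    using J by (auto simp: power_module_def PiE_iff intro!: additive_subgroup.a_closed ideal.axioms(1))
next
  fix r v assume "r \<in> carrier R" "v \<in> Pi\<^sub>E {1..n} J"
  then show "r \<odot>\<^bsub>V\<^esub> v \<in> Pi\<^sub>E {1..n} J"
    using J by (auto simp: power_module_def PiE_iff intro!: ideal.I_l_closed)
qed

text \<open>The double annihilator property, coordinate by coordinate. A product of ideals contains
  words supported at a single coordinate, so orthogonality to it can be tested at each coordinate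
  separately.\<close>

lemma dual_PiE_annihilator:
  assumes c: "\<And>l. l \<in> {1..n} \<Longrightarrow> c l \<in> carrier R"
  shows "dual_code R n (\<Pi>\<^sub>E l\<in>{1..n}. annihilator R (c l)) = (\<Pi>\<^sub>E l\<in>{1..n}. PIdl (c l))"
proof -
  let ?N = "\<Pi>\<^sub>E l\<in>{1..n}. annihilator R (c l)" and ?P = "\<Pi>\<^sub>E l\<in>{1..n}. PIdl (c l)"
  have "submodule ?N R V" "submodule ?P R V"
    using c by (auto intro!: submodule_PiE ideal_annihilator cgenideal_ideal)
  note NV = this(1)[THEN submodule_subset] and PV = this(2)[THEN submodule_subset]
  show ?thesis
  proof
    show "dual_code R n ?N \<subseteq> ?P"
    proof
      fix v assume v: "v \<in> dual_code R n ?N"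
      then have vV: "v \<in> carrier V" by (simp add: mem_dual_iff)
      have "v l \<in> PIdl (c l)" if l: "l \<in> {1..n}" for l
      proof -
        \<comment> \<open>Orthogonality to the single word with \<open>d\<close> at position
          \<open>l\<close> forces \<open>v l\<close> into ann(d), which equals c_l R because
          \<open>d\<close> generates ann(c_l).\<close>
        obtain d where d: "d \<in> carrier R" "annihilator R (c l) = PIdl d"
          using ideal_principal ideal_annihilator c l by blast
        have "d \<in> annihilator R (c l)" using d cgenideal_self by simp
        then have "unit_vec l d \<in> ?N"
          using c by (auto simp: unit_vec_def annihilator_def)
        then have "dot (unit_vec l d) v = \<zero>" using v by (simp add: mem_dual_iff)
        then have "v l \<in> annihilator R d"
          using dot_unit_vec[OF l d(1) vV] l vV by (simp add: annihilator_def)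
        then show ?thesis using annihilator_generator[OF c[OF l] d] by simp
      qed
      then show "v \<in> ?P" using vV by (auto simp: carrier_V PiE_iff)
    qed
    show "?P \<subseteq> dual_code R n ?N"
    proof
      fix v assume v: "v \<in> ?P"
      have "dot u v = \<zero>" if u: "u \<in> ?N" for u
      proof -
        have "u l \<otimes> v l = \<zero>" if l: "l \<in> {1..n}" for l
        proof -
          have "v l \<in> PIdl (c l)" "u l \<in> annihilator R (c l)" using u v l by (auto simp: PiE_iff)
          then obtain r where "r \<in> carrier R" "v l = r \<otimes> c l" "u l \<in> carrier R" "c l \<otimes> u l = \<zero>"
            by (auto simp: mem_PIdl_iff annihilator_def)
          then show ?thesis using c[OF l] by (simp add: m_lcomm m_comm[of "u l" "c l"])
        qed
        then show ?thesis unfolding dot_def by (rule add.finprod_one_eqI)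
      qed
      then show "v \<in> dual_code R n ?N" using v PV by (auto simp: mem_dual_iff)
    qed
  qed
qed

text \<open>Apply \<open>card_dual\<close> to \<open>C + J\<close>, where \<open>J\<close> is the product of the annihilators: its dual is the
  intersection on the left.\<close>

lemma card_dual_inter_PiE:
  assumes C: "submodule C R V" and c: "\<And>l. l \<in> {1..n} \<Longrightarrow> c l \<in> carrier R"
  shows "card (dual_code R n C \<inter> (\<Pi>\<^sub>E l\<in>{1..n}. PIdl (c l))) * card C
    = (\<Prod>l\<in>{1..n}. card (PIdl (c l))) * card (C \<inter> (\<Pi>\<^sub>E l\<in>{1..n}. annihilator R (c l)))"
proof -
  let ?N = "\<Pi>\<^sub>E l\<in>{1..n}. annihilator R (c l)" and ?P = "\<Pi>\<^sub>E l\<in>{1..n}. PIdl (c l)"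
  have N: "submodule ?N R V"
    using c by (auto intro!: submodule_PiE ideal_annihilator)
  have D: "dual_code R n (C <+>\<^bsub>V\<^esub> ?N) = dual_code R n C \<inter> ?P"
    by (simp only: dual_set_add[OF C N] dual_PiE_annihilator[OF c])
  have pos: "card ?N > 0"
    using submodule_zero[OF N] submodule_finite[OF N] by (auto simp: card_gt_0_iff)
  have sum_card: "card (C <+>\<^bsub>V\<^esub> ?N) * card (C \<inter> ?N) = card C * card ?N"
    by (rule card_subgroup_sum[OF V.abelian_group_axioms finite_carrier_V
          submodule_subgroup[OF C] submodule_subgroup[OF N]])
  have dual_card: "card ?N * card ?P = card (C <+>\<^bsub>V\<^esub> ?N) * card (dual_code R n C \<inter> ?P)"
    using card_dual[OF N] card_dual[OF submodule_set_add[OF C N]]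
    by (simp only: D dual_PiE_annihilator[OF c])
  \<comment> \<open>Elimination of |C + N| between \<open>sum_card\<close> and
    \<open>dual_card\<close>; the common factor |N| is positive and cancels.\<close>
  have "card ?N * (card ?P * card (C \<inter> ?N)) = (card ?N * card ?P) * card (C \<inter> ?N)"
    by (simp only: ac_simps)
  also have "\<dots> = card (dual_code R n C \<inter> ?P) * (card (C <+>\<^bsub>V\<^esub> ?N) * card (C \<inter> ?N))"
    unfolding dual_card by (simp only: ac_simps)
  also have "\<dots> = card ?N * (card (dual_code R n C \<inter> ?P) * card C)"
    unfolding sum_card by (simp only: ac_simps)
  finally have "card ?P * card (C \<inter> ?N) = card (dual_code R n C \<inter> ?P) * card C"
    using pos by (metis nat_mult_eq_cancel1)
  moreover have "card ?P = (\<Prod>l\<in>{1..n}. card (PIdl (c l)))"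
    by (rule card_PiE) simp
  ultimately show ?thesis by simp
qed

end

subsection \<open>Sums of principal ideals\<close>

context finite_principal_ring
begin

lemma ideal_sum_0: "ideal_sum R 0 b = {\<zero>}"
  by (auto simp: ideal_sum_def)

text \<open>Reduces the k-fold sum to the sum of two ideals, so that facts on two summands carry
  over by induction.\<close>

lemma ideal_sum_Suc:
  assumes b: "\<And>m. m \<in> {1..Suc k} \<Longrightarrow> b m \<in> carrier R"
  shows "ideal_sum R (Suc k) b = PIdl (b (Suc k)) <+>\<^bsub>R\<^esub> ideal_sum R k b"
proof -
  have sub: "PIdl (b m) \<subseteq> carrier R" if "m \<in> {1..Suc k}" for m
    using b[OF that] by (auto simp: mem_PIdl_iff)
  have eq: "(\<Oplus>m\<in>{1..Suc k}. x m) = x (Suc k) \<oplus> (\<Oplus>m\<in>{1..k}. x m)"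
    if "\<And>m. m \<in> {1..Suc k} \<Longrightarrow> x m \<in> PIdl (b m)" for x
  proof -
    have "x m \<in> carrier R" if "m \<in> {1..Suc k}" for m
      using sub that \<open>\<And>m. m \<in> {1..Suc k} \<Longrightarrow> x m \<in> PIdl (b m)\<close> by blast
    then show ?thesis
      by (simp add: atLeastAtMostSuc_conv Pi_def)
  qed
  show ?thesis
  proof
    show "ideal_sum R (Suc k) b \<subseteq> PIdl (b (Suc k)) <+>\<^bsub>R\<^esub> ideal_sum R k b"
    proof
      fix s assume "s \<in> ideal_sum R (Suc k) b"
      then obtain x where x: "\<And>m. m \<in> {1..Suc k} \<Longrightarrow> x m \<in> PIdl (b m)" "s = (\<Oplus>m\<in>{1..Suc k}. x m)"
        unfolding ideal_sum_def by blast
      then have "s = x (Suc k) \<oplus> (\<Oplus>m\<in>{1..k}. x m)" using eq by simp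
      moreover have "(\<Oplus>m\<in>{1..k}. x m) \<in> ideal_sum R k b"
        using x(1) by (auto simp: ideal_sum_def)
      ultimately show "s \<in> PIdl (b (Suc k)) <+>\<^bsub>R\<^esub> ideal_sum R k b"
        using x(1)[of "Suc k"] by (auto simp: set_add_def')
    qed
    show "PIdl (b (Suc k)) <+>\<^bsub>R\<^esub> ideal_sum R k b \<subseteq> ideal_sum R (Suc k) b"
    proof
      fix s assume "s \<in> PIdl (b (Suc k)) <+>\<^bsub>R\<^esub> ideal_sum R k b"
      then obtain y x where y: "y \<in> PIdl (b (Suc k))" and x: "\<And>m. m \<in> {1..k} \<Longrightarrow> x m \<in> PIdl (b m)"
        and s: "s = y \<oplus> (\<Oplus>m\<in>{1..k}. x m)"
        unfolding ideal_sum_def set_add_def' by blast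
      define z where "z = x(Suc k := y)"
      have z: "z m \<in> PIdl (b m)" if "m \<in> {1..Suc k}" for m
        using that x y by (cases "m = Suc k") (auto simp: z_def)
      have "(\<Oplus>m\<in>{1..k}. z m) = (\<Oplus>m\<in>{1..k}. x m)"
        using x sub by (intro finsum_cong') (fastforce simp: z_def)+
      then have "s = (\<Oplus>m\<in>{1..Suc k}. z m)"
        using eq[OF z] s by (simp add: z_def)
      then show "s \<in> ideal_sum R (Suc k) b"
        using z unfolding ideal_sum_def by blast
    qed
  qed
qed

lemma ideal_ideal_sum:
  assumes "\<And>m. m \<in> {1..k} \<Longrightarrow> b m \<in> carrier R"
  shows "ideal (ideal_sum R k b) R"
  using assms
proof (induction k)
  case (Suc k)
  show ?case
    by (subst ideal_sum_Suc, rule Suc.prems, assumption)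
      (intro add_ideals cgenideal_ideal Suc; simp)
qed (simp add: ideal_sum_0 zeroideal)

text \<open>The sum is the least ideal containing all b_m. Hence an inclusion, unlike an equality,
  is a separate condition on each b_m.\<close>

lemma ideal_sum_subset_iff:
  assumes "\<And>m. m \<in> {1..k} \<Longrightarrow> b m \<in> carrier R" and I: "ideal I R"
  shows "ideal_sum R k b \<subseteq> I \<longleftrightarrow> (\<forall>m\<in>{1..k}. b m \<in> I)"
  using assms(1)
proof (induction k)
  case 0
  then show ?case
    using I by (simp add: ideal_sum_0 additive_subgroup.zero_closed ideal.axioms(1))
next
  case (Suc k)
  have J: "ideal (ideal_sum R k b) R" by (rule ideal_ideal_sum) (use Suc.prems in auto)
  have P: "ideal (PIdl (b (Suc k))) R" by (rule cgenideal_ideal) (use Suc.prems in auto)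
  have "PIdl (b (Suc k)) <+>\<^bsub>R\<^esub> ideal_sum R k b \<subseteq> I \<longleftrightarrow> PIdl (b (Suc k)) \<union> ideal_sum R k b \<subseteq> I"
  proof
    assume "PIdl (b (Suc k)) <+>\<^bsub>R\<^esub> ideal_sum R k b \<subseteq> I"
    then show "PIdl (b (Suc k)) \<union> ideal_sum R k b \<subseteq> I"
      using union_genideal[OF P J] genideal_self[of "PIdl (b (Suc k)) \<union> ideal_sum R k b"]
        ideal.Icarr[OF P] ideal.Icarr[OF J] by blast
  next
    assume "PIdl (b (Suc k)) \<union> ideal_sum R k b \<subseteq> I"
    then show "PIdl (b (Suc k)) <+>\<^bsub>R\<^esub> ideal_sum R k b \<subseteq> I"
      using I by (auto simp: set_add_def' intro!: additive_subgroup.a_closed ideal.axioms(1))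
  qed
  also have "\<dots> \<longleftrightarrow> (\<forall>m\<in>{1..Suc k}. b m \<in> I)"
    using Suc PIdl_subset_iff[OF _ I, of "b (Suc k)"] by (auto simp: atLeastAtMostSuc_conv)
  finally show ?case
    by (simp only: ideal_sum_Suc[OF Suc.prems])
qed

end

subsection \<open>Enumerators as sums over tuples of code words\<close>

lemma psubst_add: "psubst s (p + q) = psubst s p + psubst s q"
  unfolding psubst_def
  by (rule setsum_keys_plus_distrib) (simp_all add: pconst_def single_add distrib_right)

lemma psubst_zero: "psubst s 0 = 0"
  by (simp add: psubst_def)

lemma psubst_sum: "psubst s (\<Sum>x\<in>A. f x) = (\<Sum>x\<in>A. psubst s (f x))"
  by (induction A rule: infinite_finite_induct) (simp_all add: psubst_add psubst_zero)

lemma prod_pvar: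
  "(\<Prod>v\<in>A. pvar v) = Poly_Mapping.single (\<Sum>v\<in>A. Poly_Mapping.single v (1::nat)) (1::'a::comm_semiring_1)"
  by (induction A rule: infinite_finite_induct) (simp_all add: pvar_def mult_single)

text \<open>A product of distinct variables is the monomial with exponent 1 on \<open>A\<close>. The
  monomials of the enumerators have this shape, so with \<open>psubst_sum\<close> this evaluates
  every substitution into them.\<close>

lemma psubst_prod_pvar:
  fixes s :: "'v \<Rightarrow> ('w, 'a::comm_semiring_1) mpoly"
  assumes "finite A"
  shows "psubst s (\<Prod>v\<in>A. pvar v) = (\<Prod>v\<in>A. s v)"
proof -
  define m where "m = (\<Sum>v\<in>A. Poly_Mapping.single v (1::nat))"
  have lookup: "Poly_Mapping.lookup m v = (if v \<in> A then 1 else 0)" for v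
  proof -
    have "Poly_Mapping.lookup m v = (\<Sum>w\<in>A. if w = v then 1 else 0)"
      unfolding m_def lookup_sum by (rule sum.cong) (simp_all add: lookup_single when_def)
    then show ?thesis using assms by simp
  qed
  then have keys: "Poly_Mapping.keys m = A"
    by (auto simp: in_keys_iff split: if_splits)
  have "psubst s (\<Prod>v\<in>A. pvar v) = (\<Prod>v\<in>Poly_Mapping.keys m. s v ^ Poly_Mapping.lookup m v)"
    unfolding prod_pvar m_def[symmetric] psubst_def by (simp add: pconst_def)
  also have "\<dots> = (\<Prod>v\<in>A. s v)"
    unfolding keys by (rule prod.cong) (simp_all add: lookup)
  finally show ?thesis .
qed

lemma pconst_0: "pconst 0 = 0" and pconst_1: "pconst 1 = 1"
  by (simp_all add: pconst_def)

lemma pconst_add: "pconst (a + b) = pconst a + pconst b"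
  by (simp add: pconst_def single_add)

lemma pconst_mult: "pconst (a * b) = pconst a * pconst b"
  by (simp add: pconst_def mult_single)

lemma pconst_sum: "pconst (\<Sum>x\<in>A. f x) = (\<Sum>x\<in>A. pconst (f x))"
  by (induction A rule: infinite_finite_induct) (simp_all add: pconst_add pconst_0)

lemma pconst_of_nat: "pconst (of_nat m) = of_nat m"
  by (induction m) (simp_all add: pconst_add pconst_0 pconst_1)

text \<open>Submultisets of t copies of \<open>A\<close> correspond to functions from
  \<open>A\<close> to {0..t}. This is the existence half; \<open>submultiset_eqI\<close> is the
  uniqueness half.\<close>

lemma multiset_of_multiplicities:
  fixes f :: "nat \<Rightarrow> nat"
  assumes "finite A" "\<And>l. l \<in> A \<Longrightarrow> f l \<le> t"
  obtains Z where "Z \<subseteq># repeat_mset t (mset_set A)" "\<And>l. l \<in> A \<Longrightarrow> count Z l = f l"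
proof
  let ?Z = "\<Sum>l\<in>A. replicate_mset (f l) l"
  have count: "count ?Z x = (if x \<in> A then f x else 0)" for x
    using assms(1) by (simp add: count_sum)
  show "?Z \<subseteq># repeat_mset t (mset_set A)"
    using assms by (auto simp: subseteq_mset_def count)
  show "count ?Z l = f l" if "l \<in> A" for l
    using that by (simp add: count)
qed

lemma submultiset_eqI:
  assumes "finite A" "Y \<subseteq># repeat_mset t (mset_set A)" "Z \<subseteq># repeat_mset t (mset_set A)"
    and "\<And>l. l \<in> A \<Longrightarrow> count Y l = count Z l"
  shows "Y = Z"
proof (rule multiset_eqI)
  fix x
  have "count W x \<le> 0" if "x \<notin> A" "W \<subseteq># repeat_mset t (mset_set A)" for W
    using mset_subset_eq_count[OF that(2), of x] that(1) assms(1) by simp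
  then show "count Y x = count Z x"
    using assms by (cases "x \<in> A") auto
qed

section \<open>Numbering the ideals by 0, ..., t\<close>

locale indexed_principal_ideals = code_space +
  fixes t :: nat and a :: "nat \<Rightarrow> 'a"
  assumes t_eq: "t = card {I. (\<exists>c\<in>carrier R. I = PIdl c) \<and> I \<noteq> {\<zero>}}"
    and a_closed: "\<And>i. i \<le> t \<Longrightarrow> a i \<in> carrier R"
    and inj_PIdl: "inj_on (\<lambda>i. PIdl (a i)) {0..t}"
begin

text \<open>By counting: \<open>t\<close> nonzero principal ideals and the zero ideal make t + 1, as
  many as the distinct a_i R. So these exhaust the principal ideals, and every ideal is
  principal.\<close>

lemma ex_index:
  assumes I: "ideal I R"
  shows "\<exists>i\<le>t. PIdl (a i) = I"
proof -
  define P where "P = {I. \<exists>c\<in>carrier R. I = PIdl c}"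
  have finP: "finite P"
    by (rule finite_subset[of _ "Pow (carrier R)"])
      (auto simp: P_def mem_PIdl_iff finite_carrier)
  have z: "{\<zero>} \<in> P"
    by (auto simp: P_def mem_PIdl_iff intro!: bexI[of _ \<zero>] exI[of _ \<zero>])
  have "card P = card (insert {\<zero>} (P - {{\<zero>}}))" using z by (simp add: insert_absorb)
  also have "\<dots> = Suc (card (P - {{\<zero>}}))" using finP by (subst card_insert_disjoint) auto
  also have "P - {{\<zero>}} = {I. (\<exists>c\<in>carrier R. I = PIdl c) \<and> I \<noteq> {\<zero>}}"
    by (auto simp: P_def)
  finally have "card P = Suc t"
    unfolding t_eq .
  then have "card P = card ((\<lambda>i. PIdl (a i)) ` {0..t})"
    by (simp add: card_image[OF inj_PIdl])
  moreover have "(\<lambda>i. PIdl (a i)) ` {0..t} \<subseteq> P"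
    using a_closed by (auto simp: P_def)
  ultimately have "(\<lambda>i. PIdl (a i)) ` {0..t} = P"
    using finP by (metis card_subset_eq)
  moreover have "I \<in> P" using ideal_principal[OF I] by (auto simp: P_def)
  ultimately show ?thesis by (metis (mono_tags, lifting) atLeastAtMost_iff imageE)
qed

text \<open>Inverse of the numbering; on ideals the choice exists by \<open>ex_index\<close> and is
  unique by \<open>inj_PIdl\<close>.\<close>

definition index :: "'a set \<Rightarrow> nat" where
  "index I = (SOME i. i \<le> t \<and> PIdl (a i) = I)"

lemma index:
  assumes "ideal I R"
  shows "index I \<le> t" "PIdl (a (index I)) = I"
  using someI_ex[OF ex_index[OF assms], folded index_def] by auto

lemma index_eq_iff:
  assumes "ideal I R" "i \<le> t"
  shows "I = PIdl (a i) \<longleftrightarrow> index I = i"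
  using index[OF assms(1)] assms(2) inj_PIdl by (auto simp: inj_on_def)

lemma ideal_PIdl: "i \<le> t \<Longrightarrow> ideal (PIdl (a i)) R"
  by (simp add: a_closed cgenideal_ideal)

text \<open>For a tuple of words in R^n, each coordinate \<open>l\<close> lies in exactly one of the
  supports S_0, ..., S_t; this is the index of that support.\<close>

definition col_index :: "nat \<Rightarrow> (nat \<Rightarrow> nat \<Rightarrow> 'a) \<Rightarrow> nat \<Rightarrow> nat" where
  "col_index k c l = index (ideal_sum R k (\<lambda>m. c m l))"

lemma col_index:
  assumes "C \<subseteq> carrier V" "c \<in> {1..k} \<rightarrow>\<^sub>E C" "l \<in> {1..n}"
  shows "col_index k c l \<le> t"
    and "PIdl (a (col_index k c l)) = ideal_sum R k (\<lambda>m. c m l)"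
    and "i \<le> t \<Longrightarrow> ideal_sum R k (\<lambda>m. c m l) = PIdl (a i) \<longleftrightarrow> col_index k c l = i"
    and "ideal I R \<Longrightarrow> PIdl (a (col_index k c l)) \<subseteq> I \<longleftrightarrow> (\<forall>m\<in>{1..k}. c m l \<in> I)"
proof -
  have cl: "c m l \<in> carrier R" if "m \<in> {1..k}" for m
    using PiE_mem[OF assms(2) that] assms(1,3) by auto
  then have I: "ideal (ideal_sum R k (\<lambda>m. c m l)) R" by (rule ideal_ideal_sum)
  show "col_index k c l \<le> t" "PIdl (a (col_index k c l)) = ideal_sum R k (\<lambda>m. c m l)"
    using index[OF I] by (simp_all add: col_index_def)
  then show "PIdl (a (col_index k c l)) \<subseteq> I \<longleftrightarrow> (\<forall>m\<in>{1..k}. c m l \<in> I)" if "ideal I R"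
    using ideal_sum_subset_iff[OF cl that] by simp
  show "ideal_sum R k (\<lambda>m. c m l) = PIdl (a i) \<longleftrightarrow> col_index k c l = i" if "i \<le> t"
    using index_eq_iff[OF I that] by (simp add: col_index_def)
qed

text \<open>The supports of a tuple determine exactly one multiset Z. Grouping the tuples by their Z
  turns the coefficient of each monomial into a sum of ones.\<close>

lemma sse_eq_sum:
  assumes C: "C \<subseteq> carrier V"
  shows "sse R n t a k C = (\<Sum>c\<in>{1..k} \<rightarrow>\<^sub>E C. \<Prod>l\<in>{1..n}. pvar (col_index k c l, l))"
proof -
  let ?S = "{1..k} \<rightarrow>\<^sub>E C" and ?T = "{Z. Z \<subseteq># repeat_mset t (mset_set {1..n})}"
  let ?h = "\<lambda>c. \<Prod>l\<in>{1..n}. pvar (col_index k c l, l) :: (nat \<times> nat, rat) mpoly"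
  have finC: "finite C" using C finite_carrier_V finite_subset by blast
  have "\<forall>c. \<exists>Z. c \<in> ?S \<longrightarrow> Z \<in> ?T \<and> (\<forall>l\<in>{1..n}. count Z l = col_index k c l)"
  proof
    fix c
    show "\<exists>Z. c \<in> ?S \<longrightarrow> Z \<in> ?T \<and> (\<forall>l\<in>{1..n}. count Z l = col_index k c l)"
    proof (cases "c \<in> ?S")
      case True
      then show ?thesis
        using multiset_of_multiplicities[of "{1..n}" "col_index k c" t] col_index(1)[OF C True]
        by (metis finite_atLeastAtMost mem_Collect_eq)
    qed simp
  qed
  \<comment> \<open>\<open>g c\<close> is the only Z whose coefficient counts the tuple
    \<open>c\<close>: its multiplicities are the column indices.\<close>
  then obtain g where g: "\<And>c. c \<in> ?S \<Longrightarrow> g c \<in> ?T"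
      "\<And>c l. c \<in> ?S \<Longrightarrow> l \<in> {1..n} \<Longrightarrow> count (g c) l = col_index k c l"
    by metis
  have bound: "count Z l \<le> t" if "Z \<in> ?T" "l \<in> {1..n}" for Z l
    using mset_subset_eq_count[of Z "repeat_mset t (mset_set {1..n})" l] that by simp
  have level: "(\<forall>i\<le>t. tuple_support R n a k i c = mult_level n i Z) \<longleftrightarrow> g c = Z"
    if c: "c \<in> ?S" and Z: "Z \<in> ?T" for c Z
  proof -
    have "(\<forall>i\<le>t. tuple_support R n a k i c = mult_level n i Z)
        \<longleftrightarrow> (\<forall>l\<in>{1..n}. col_index k c l = count Z l)"
      using col_index(1,3)[OF C c] bound[OF Z] unfolding tuple_support_def mult_level_def set_eq_iff mem_Collect_eq
      by metis
    also have "\<dots> \<longleftrightarrow> g c = Z"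
      using g[OF c] submultiset_eqI[of "{1..n}" "g c" t Z] Z by auto
    finally show ?thesis .
  qed
  have "of_nat (support_count R n t a k C Z) *
      (\<Prod>i\<in>{0..t}. \<Prod>l\<in>mult_level n i Z. pvar (i, l)) = (\<Sum>c\<in>{c \<in> ?S. g c = Z}. ?h c)"
    if Z: "Z \<in> ?T" for Z
  proof -
    have "(\<Prod>i\<in>{0..t}. \<Prod>l\<in>mult_level n i Z. pvar (i, l))
        = (\<Prod>i\<in>{0..t}. \<Prod>l\<in>mult_level n i Z. pvar (count Z l, l))"
      by (intro prod.cong) (auto simp: mult_level_def)
    \<comment> \<open>The levels M_0(Z), ..., M_t(Z) partition [n], because no multiplicity in Z
      exceeds \<open>t\<close>.\<close>
    also have "\<dots> = (\<Prod>l\<in>{1..n}. pvar (count Z l, l) :: (nat \<times> nat, rat) mpoly)"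
      unfolding mult_level_def using bound[OF Z] by (intro prod.group) auto
    finally have "(\<Prod>i\<in>{0..t}. \<Prod>l\<in>mult_level n i Z. pvar (i, l)) = ?h c"
      if "c \<in> ?S" "g c = Z" for c
      using g(2)[OF that(1)] that(2) by simp
    then have "(\<Sum>c\<in>{c \<in> ?S. g c = Z}. ?h c)
        = (\<Sum>c\<in>{c \<in> ?S. g c = Z}. \<Prod>i\<in>{0..t}. \<Prod>l\<in>mult_level n i Z. pvar (i, l))"
      by (intro sum.cong) auto
    moreover have "{c \<in> ?S. g c = Z} = {c \<in> ?S. \<forall>i\<le>t. tuple_support R n a k i c = mult_level n i Z}"
      using level[OF _ Z] by blast
    ultimately show ?thesis by (simp add: support_count_def)
  qed
  then have "sse R n t a k C = (\<Sum>Z\<in>?T. \<Sum>c\<in>{c \<in> ?S. g c = Z}. ?h c)"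
    unfolding sse_def by (intro sum.cong) auto
  also have "\<dots> = sum ?h ?S"
    by (rule sum.group) (use g(1) finC in \<open>auto simp: finite_submultisets intro!: finite_PiE\<close>)
  finally show ?thesis .
qed

lemma psubst_sse:
  assumes C: "C \<subseteq> carrier V"
  shows "psubst s (sse R n t a k C) = (\<Sum>c\<in>{1..k} \<rightarrow>\<^sub>E C. \<Prod>l\<in>{1..n}. s (col_index k c l, l))"
proof -
  have "psubst s (\<Prod>l\<in>{1..n}. pvar (f l, l)) = (\<Prod>l\<in>{1..n}. s (f l, l))" for f
  proof -
    \<comment> \<open>The variables of one monomial lie in different columns, hence are
      distinct.\<close>
    have inj: "inj_on (\<lambda>l. (f l, l)) {1..n}" by (auto simp: inj_on_def)
    show ?thesis
      using psubst_prod_pvar[of "(\<lambda>l. (f l, l)) ` {1..n}" s]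
      by (simp add: prod.reindex[OF inj] del: atLeastAtMost_iff)
  qed
  then show ?thesis by (simp add: sse_eq_sum[OF C] psubst_sum)
qed

text \<open>Expanding the product over the coordinates turns the sum over tuples into a sum over the
  ways \<open>g\<close> of choosing one ideal per coordinate. The condition on a tuple then concerns each of
  its \<open>k\<close> members separately, so it contributes a \<open>k\<close>-th power.\<close>

lemma sum_tuples_expand:
  fixes z :: "nat \<Rightarrow> nat \<Rightarrow> 'c::comm_semiring_1"
  assumes C: "C \<subseteq> carrier V" and I: "\<And>j. j \<le> t \<Longrightarrow> ideal (I j) R"
  shows "(\<Sum>c\<in>{1..k} \<rightarrow>\<^sub>E C. \<Prod>l\<in>{1..n}. \<Sum>j\<in>{0..t}.
        if PIdl (a (col_index k c l)) \<subseteq> I j then z j l else 0)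
    = (\<Sum>g\<in>{1..n} \<rightarrow>\<^sub>E {0..t}.
        of_nat (card (C \<inter> (\<Pi>\<^sub>E l\<in>{1..n}. I (g l))) ^ k) * (\<Prod>l\<in>{1..n}. z (g l) l))"
proof -
  let ?S = "{1..k} \<rightarrow>\<^sub>E C"
  have finS: "finite ?S"
    using finite_subset[OF C finite_carrier_V] by (intro finite_PiE) auto
  have inner: "(\<Sum>c\<in>?S. \<Prod>l\<in>{1..n}. if PIdl (a (col_index k c l)) \<subseteq> I (g l) then z (g l) l else 0)
      = of_nat (card (C \<inter> (\<Pi>\<^sub>E l\<in>{1..n}. I (g l))) ^ k) * (\<Prod>l\<in>{1..n}. z (g l) l)"
    if g: "g \<in> {1..n} \<rightarrow>\<^sub>E {0..t}" for g
  proof -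
    let ?B = "C \<inter> (\<Pi>\<^sub>E l\<in>{1..n}. I (g l))"
    have gI: "ideal (I (g l)) R" if "l \<in> {1..n}" for l
      using I PiE_mem[OF g that] by simp
    \<comment> \<open>The inclusions at all coordinates say precisely that every member of the tuple
      is a word of \<open>?B\<close>, so the surviving tuples are all k-tuples over
      \<open>?B\<close>.\<close>
    have iff: "(\<forall>l\<in>{1..n}. PIdl (a (col_index k c l)) \<subseteq> I (g l)) \<longleftrightarrow> c \<in> {1..k} \<rightarrow>\<^sub>E ?B"
      if c: "c \<in> ?S" for c
    proof -
      have "(\<forall>l\<in>{1..n}. PIdl (a (col_index k c l)) \<subseteq> I (g l))
          \<longleftrightarrow> (\<forall>m\<in>{1..k}. \<forall>l\<in>{1..n}. c m l \<in> I (g l))"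
        using col_index(4)[OF C c _ gI] by blast
      also have "\<dots> \<longleftrightarrow> (\<forall>m\<in>{1..k}. c m \<in> ?B)"
        using c C by (auto simp: PiE_iff carrier_V subset_eq)
      also have "\<dots> \<longleftrightarrow> c \<in> {1..k} \<rightarrow>\<^sub>E ?B"
        using c by (auto simp: PiE_iff)
      finally show ?thesis .
    qed
    have "(\<Sum>c\<in>?S. \<Prod>l\<in>{1..n}. if PIdl (a (col_index k c l)) \<subseteq> I (g l) then z (g l) l else 0)
        = (\<Sum>c\<in>?S. if c \<in> {1..k} \<rightarrow>\<^sub>E ?B then \<Prod>l\<in>{1..n}. z (g l) l else 0)"
    proof (rule sum.cong[OF refl])
      fix c assume c: "c \<in> ?S"
      show "(\<Prod>l\<in>{1..n}. if PIdl (a (col_index k c l)) \<subseteq> I (g l) then z (g l) l else 0)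
          = (if c \<in> {1..k} \<rightarrow>\<^sub>E ?B then \<Prod>l\<in>{1..n}. z (g l) l else 0)"
      proof (cases "c \<in> {1..k} \<rightarrow>\<^sub>E ?B")
        case True
        then show ?thesis using iff[OF c] by (simp del: Pi_split_insert_domain)
      next
        case False
        then obtain l where "l \<in> {1..n}" "\<not> PIdl (a (col_index k c l)) \<subseteq> I (g l)"
          using iff[OF c] by blast
        then show ?thesis using False by (subst prod_zero) auto
      qed
    qed
    also have "\<dots> = (\<Sum>c\<in>?S \<inter> {c. c \<in> {1..k} \<rightarrow>\<^sub>E ?B}. \<Prod>l\<in>{1..n}. z (g l) l)"
      by (rule sum.inter_restrict[OF finS, symmetric, where B="{c. c \<in> {1..k} \<rightarrow>\<^sub>E ?B}", simplified mem_Collect_eq])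
    also have "?S \<inter> {c. c \<in> {1..k} \<rightarrow>\<^sub>E ?B} = {1..k} \<rightarrow>\<^sub>E ?B"
      using PiE_mono[of "{1..k}" "\<lambda>_. ?B" "\<lambda>_. C"] by auto
    finally show ?thesis by (simp add: card_PiE)
  qed
  have "(\<Sum>c\<in>?S. \<Prod>l\<in>{1..n}. \<Sum>j\<in>{0..t}. if PIdl (a (col_index k c l)) \<subseteq> I j then z j l else 0)
      = (\<Sum>c\<in>?S. \<Sum>g\<in>{1..n} \<rightarrow>\<^sub>E {0..t}.
          \<Prod>l\<in>{1..n}. if PIdl (a (col_index k c l)) \<subseteq> I (g l) then z (g l) l else 0)"
    by (intro sum.cong prod_sum_PiE) auto
  also have "\<dots> = (\<Sum>g\<in>{1..n} \<rightarrow>\<^sub>E {0..t}. \<Sum>c\<in>?S.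
          \<Prod>l\<in>{1..n}. if PIdl (a (col_index k c l)) \<subseteq> I (g l) then z (g l) l else 0)"
    by (rule sum.swap)
  also have "\<dots> = (\<Sum>g\<in>{1..n} \<rightarrow>\<^sub>E {0..t}.
        of_nat (card (C \<inter> (\<Pi>\<^sub>E l\<in>{1..n}. I (g l))) ^ k) * (\<Prod>l\<in>{1..n}. z (g l) l))"
    by (rule sum.cong[OF refl inner])
  finally show ?thesis .
qed

text \<open>Both sides are expanded over the choices \<open>g\<close> of one ideal per coordinate.
  For each \<open>g\<close> the coefficients agree by the k-th power of
  \<open>card_dual_inter_PiE\<close>; the factors |a_j R|^k on the right come from the size of the
  product of ideals.\<close>

lemma macwilliams:
  fixes y :: "nat \<Rightarrow> nat \<Rightarrow> 'c::comm_semiring_1"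
  assumes C: "submodule C R V"
  shows "of_nat (card C ^ k) * (\<Sum>c\<in>{1..k} \<rightarrow>\<^sub>E dual_code R n C. \<Prod>l\<in>{1..n}. \<Sum>j\<in>{0..t}.
        if PIdl (a (col_index k c l)) \<subseteq> PIdl (a j) then y j l else 0)
    = (\<Sum>c\<in>{1..k} \<rightarrow>\<^sub>E C. \<Prod>l\<in>{1..n}. \<Sum>j\<in>{0..t}.
        if PIdl (a (col_index k c l)) \<subseteq> annihilator R (a j)
        then of_nat (card (PIdl (a j)) ^ k) * y j l else 0)"
proof -
  note CV = submodule_subset[OF C]
  have DV: "dual_code R n C \<subseteq> carrier V" by (rule submodule_subset[OF submodule_dual[OF CV]])
  show ?thesis
  proof (subst sum_tuples_expand[OF DV], erule ideal_PIdl,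
      subst sum_tuples_expand[OF CV], rule ideal_annihilator, erule a_closed,
      unfold sum_distrib_left, rule sum.cong[OF refl])
    fix g assume g: "g \<in> {1..n} \<rightarrow>\<^sub>E {0..t}"
    have "a (g l) \<in> carrier R" if "l \<in> {1..n}" for l
      using PiE_mem[OF g that] by (simp add: a_closed)
    from card_dual_inter_PiE[OF C this]
    have "card C ^ k * card (dual_code R n C \<inter> (\<Pi>\<^sub>E l\<in>{1..n}. PIdl (a (g l)))) ^ k
        = card (C \<inter> (\<Pi>\<^sub>E l\<in>{1..n}. annihilator R (a (g l)))) ^ k * (\<Prod>l\<in>{1..n}. card (PIdl (a (g l))) ^ k)"
      unfolding power_mult_distrib[symmetric] prod_power_distrib[symmetric] by (simp add: mult.commute)
    then show "of_nat (card C ^ k) * (of_nat (card (dual_code R n C \<inter> (\<Pi>\<^sub>E l\<in>{1..n}. PIdl (a (g l)))) ^ k) * (\<Prod>l\<in>{1..n}. y (g l) l))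
        = of_nat (card (C \<inter> (\<Pi>\<^sub>E l\<in>{1..n}. annihilator R (a (g l)))) ^ k) *
          (\<Prod>l\<in>{1..n}. of_nat (card (PIdl (a (g l))) ^ k) * y (g l) l)"
      unfolding prod.distrib of_nat_prod[symmetric] mult.assoc[symmetric] of_nat_mult[symmetric] by simp
  qed
qed

end

subsection \<open>Matrices\<close>

declare One_nat_def [simp]

text \<open>Evaluate \<open>A v = 0\<close> at \<open>i\<close>: every other term that occurs belongs to a larger \<open>F j\<close>, so
  induction from large to small sets gives \<open>v = 0\<close>.\<close>

lemma inclusion_matrix_invertible:
  fixes F :: "nat \<Rightarrow> 'b set"
  assumes fin: "\<And>i. i < m \<Longrightarrow> finite (F i)" and inj: "inj_on F {..<m}"
  defines "A \<equiv> mat m m (\<lambda>(i, j). if F i \<subseteq> F j then 1 else 0) :: 'c::field mat"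
  obtains B where "mat_inverse A = Some B" "B \<in> carrier_mat m m" "A * B = 1\<^sub>m m" "B * A = 1\<^sub>m m"
proof -
  have A: "A \<in> carrier_mat m m" by (simp add: A_def)
  have "det A \<noteq> 0"
  proof
    assume "det A = 0"
    then obtain v where v: "v \<in> carrier_vec m" "v \<noteq> 0\<^sub>v m" "A *\<^sub>v v = 0\<^sub>v m"
      using det_0_iff_vec_prod_zero[OF A] by auto
    \<comment> \<open>Any common upper bound of the cardinalities would serve: it makes the
      induction measure fall as the sets grow.\<close>
    define N where "N = (\<Sum>i<m. card (F i))"
    have le: "card (F i) \<le> N" if "i < m" for i
      unfolding N_def using that by (intro member_le_sum) auto
    have "v $ i = 0" if "i < m" for i
      using that
    proof (induction "N - card (F i)" arbitrary: i rule: less_induct)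
      case less
      have "0 = (A *\<^sub>v v) $ i" using v less.prems by simp
      also have "\<dots> = (\<Sum>j<m. (if F i \<subseteq> F j then 1 else 0) * v $ j)"
        using v(1) less.prems by (simp add: A_def scalar_prod_def lessThan_atLeast0)
      also have "\<dots> = (\<Sum>j<m. if j = i then v $ j else 0)"
      proof (rule sum.cong[OF refl])
        fix j assume j: "j \<in> {..<m}"
        show "(if F i \<subseteq> F j then 1 else 0) * v $ j = (if j = i then v $ j else 0)"
        \<comment> \<open>By injectivity an inclusion between different indices is strict, so v_j
          vanishes by the induction hypothesis and only the diagonal term is left.\<close>
        proof (cases "F i \<subseteq> F j \<and> j \<noteq> i")
          case True
          then have "F i \<subset> F j" using inj j less.prems by (auto simp: inj_on_def)
          then have "card (F i) < card (F j)" using fin j by (simp add: psubset_card_mono)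
          then have "N - card (F j) < N - card (F i)" using le[of j] j by simp
          then show ?thesis using less.hyps j True by simp
        qed auto
      qed
      also have "\<dots> = v $ i" using less.prems by simp
      finally show ?case by simp
    qed
    then have "v = 0\<^sub>v m" using v(1) by auto
    with v(2) show False by simp
  qed
  then have "A \<in> Units (ring_mat TYPE('c) m ())"
    using det_non_zero_imp_unit[OF A] by simp
  then obtain B where B: "mat_inverse A = Some B"
    using mat_inverse(1)[OF A, of "()"] by (cases "mat_inverse A") auto
  with mat_inverse(2)[OF A B] that show ?thesis by blast
qed

lemma mat_diag_pow: "mat_diag m f ^\<^sub>m k = mat_diag m (\<lambda>i. f i ^ k :: 'c::semiring_1)"
  by (induction k) (simp_all add: carrier_matD(1)[OF mat_diag_dim] power_Suc2 del: power_Suc)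

context indexed_principal_ideals
begin

section \<open>The involution I -> ann(I), read on indices\<close>

definition dual_index :: "nat \<Rightarrow> nat" where
  "dual_index i = index (annihilator R (a i))"

lemma dual_index:
  assumes "i \<le> t"
  shows "dual_index i \<le> t" "PIdl (a (dual_index i)) = annihilator R (a i)"
  using index[OF ideal_annihilator[OF a_closed[OF assms]]] by (simp_all add: dual_index_def)

lemma PIdl_eq_iff: "i \<le> t \<Longrightarrow> j \<le> t \<Longrightarrow> PIdl (a i) = PIdl (a j) \<longleftrightarrow> i = j"
  using inj_PIdl by (auto simp: inj_on_def)

lemma dual_index_dual_index:
  assumes i: "i \<le> t"
  shows "dual_index (dual_index i) = i"
proof -
  have "annihilator R (a (dual_index i)) = PIdl (a i)"
    using i dual_index[OF i] by (simp add: annihilator_generator[OF a_closed[OF i] a_closed])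
  then show ?thesis
    using i dual_index by (metis PIdl_eq_iff)
qed

text \<open>Either side says that the product of a_i and a_j is zero.\<close>

lemma PIdl_subset_annihilator_iff:
  assumes "i \<le> t" "j \<le> t"
  shows "PIdl (a j) \<subseteq> annihilator R (a i) \<longleftrightarrow> PIdl (a i) \<subseteq> annihilator R (a j)"
  using assms by (simp add: PIdl_subset_iff a_closed ideal_annihilator)
    (simp add: annihilator_def a_closed m_comm)

section \<open>The matrix identities\<close>

abbreviation "A \<equiv> A_mat R t a"
abbreviation "D \<equiv> D_mat R t a"
abbreviation "Q \<equiv> Q_mat R t a"
abbreviation "A_inv \<equiv> the (mat_inverse A)"

definition swap_mat :: "rat mat" where
  "swap_mat = mat (t + 1) (t + 1) (\<lambda>(i, j). if i = dual_index j then 1 else 0)"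

lemma carrier_mats [simp]:
  "A \<in> carrier_mat (t + 1) (t + 1)" "Q \<in> carrier_mat (t + 1) (t + 1)"
  "D \<in> carrier_mat (t + 1) (t + 1)" "swap_mat \<in> carrier_mat (t + 1) (t + 1)"
  by (simp_all add: A_mat_def Q_mat_def D_mat_def swap_mat_def)

text \<open>Guarantees that \<open>the\<close> in \<open>QDA_mat\<close> yields the true inverse and
  not an unspecified value.\<close>

lemma A_inv:
  shows "A_inv \<in> carrier_mat (t + 1) (t + 1)" "A * A_inv = 1\<^sub>m (t + 1)" "A_inv * A = 1\<^sub>m (t + 1)"
proof -
  have "finite (PIdl (a i))" if "i < t + 1" for i
    using finite_subset[OF _ finite_carrier] ideal.Icarr[OF ideal_PIdl] that by (metis Suc_eq_plus1 less_Suc_eq_le subsetI)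
  moreover have "inj_on (\<lambda>i. PIdl (a i)) {..<t + 1}"
    using inj_PIdl by (rule inj_on_subset) auto
  ultimately obtain B' where "mat_inverse A = Some B'" "B' \<in> carrier_mat (t + 1) (t + 1)"
    "A * B' = 1\<^sub>m (t + 1)" "B' * A = 1\<^sub>m (t + 1)"
    unfolding A_mat_def by (rule inclusion_matrix_invertible)
  then show "A_inv \<in> carrier_mat (t + 1) (t + 1)" "A * A_inv = 1\<^sub>m (t + 1)" "A_inv * A = 1\<^sub>m (t + 1)"
    by simp_all
qed

lemma D_pow: "D ^\<^sub>m k = mat_diag (t + 1) (\<lambda>i. of_nat (card (PIdl (a i))) ^ k)"
  by (simp add: D_mat_def mat_diag_pow)

lemma mult_swap_mat:
  assumes M: "M \<in> carrier_mat (t + 1) (t + 1)"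
  shows "M * swap_mat = mat (t + 1) (t + 1) (\<lambda>(i, j). M $$ (i, dual_index j))"
proof (rule eq_matI)
  fix i j assume "i < dim_row (mat (t + 1) (t + 1) (\<lambda>(i, j). M $$ (i, dual_index j)))"
    and "j < dim_col (mat (t + 1) (t + 1) (\<lambda>(i, j). M $$ (i, dual_index j)))"
  then have ij: "i < t + 1" "j < t + 1" by simp_all
  then have j': "dual_index j < t + 1" using dual_index(1)[of j] by simp
  have "(M * swap_mat) $$ (i, j) = (\<Sum>m\<in>{0..<t + 1}. M $$ (i, m) * (if m = dual_index j then 1 else 0))"
    using ij M by (simp add: swap_mat_def scalar_prod_def)
  also have "\<dots> = (\<Sum>m\<in>{0..<t + 1}. if m = dual_index j then M $$ (i, m) else 0)"
    by (rule sum.cong) auto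
  also have "\<dots> = M $$ (i, dual_index j)" using j' by simp
  finally show "(M * swap_mat) $$ (i, j) = mat (t + 1) (t + 1) (\<lambda>(i, j). M $$ (i, dual_index j)) $$ (i, j)"
    using ij by simp
qed (use M in \<open>simp_all add: swap_mat_def\<close>)

text \<open>Entry (i, j) of the product asks whether a_i R lies in ann(a_j), while Q asks this with
  i and j exchanged; the relation is symmetric.\<close>

lemma Q_eq: "Q = A * swap_mat"
  unfolding mult_swap_mat[OF carrier_mats(1)]
  by (rule eq_matI)
    (simp_all add: Q_mat_def A_mat_def dual_index PIdl_subset_annihilator_iff less_Suc_eq_le)

lemma swap_mat_square: "swap_mat * swap_mat = 1\<^sub>m (t + 1)"
  unfolding mult_swap_mat[OF carrier_mats(4)]
proof (rule eq_matI, goal_cases)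
  case (1 i j)
  then have "i \<le> t" "j \<le> t" by simp_all
  then show ?case by (simp add: swap_mat_def dual_index dual_index_dual_index less_Suc_eq_le)
qed simp_all

lemma card_PIdl_dual_index:
  assumes "j \<le> t"
  shows "card (PIdl (a (dual_index j))) * card (PIdl (a j)) = card (carrier R)"
  using card_PIdl_annihilator[OF a_closed[OF assms]] dual_index(2)[OF assms] by simp

text \<open>The only nonzero entry of column j sits in row \<open>dual_index j\<close>, where the
  two diagonal factors multiply to (|ann(a_j)| |a_j R|)^k = |R|^k.\<close>

lemma D_swap_mat_D: "D ^\<^sub>m k * (swap_mat * D ^\<^sub>m k) = of_nat (card (carrier R)) ^ k \<cdot>\<^sub>m swap_mat"
proof (rule eq_matI, goal_cases)
  case (1 i j)
  then have ij: "i < t + 1" "j < t + 1" by (simp_all add: swap_mat_def)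
  have "(of_nat (card (PIdl (a (dual_index j)))) ^ k * of_nat (card (PIdl (a j))) ^ k :: rat)
      = of_nat (card (carrier R)) ^ k"
    using ij card_PIdl_dual_index[of j]
    by (simp add: power_mult_distrib[symmetric] of_nat_mult[symmetric] del: of_nat_mult)
  then show ?case
    unfolding D_pow mat_diag_mult_right[OF carrier_mats(4)]
    by (subst mat_diag_mult_left[OF mat_carrier]) (use ij in \<open>simp add: swap_mat_def\<close>)
qed (simp_all add: swap_mat_def D_pow mat_diag_def)

lemma D_pow_carrier: "D ^\<^sub>m k \<in> carrier_mat (t + 1) (t + 1)"
  by (rule pow_carrier_mat[OF carrier_mats(3)])

lemma QDA_square: "QDA_mat R t a k ^\<^sub>m 2 = of_nat (card (carrier R)) ^ k \<cdot>\<^sub>m 1\<^sub>m (t + 1)"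
proof -
  obtain N where N: "N = t + 1" by simp
  let ?Dk = "D ^\<^sub>m k" and ?r = "of_nat (card (carrier R)) ^ k :: rat"
  note [simp] = carrier_mats[folded N] A_inv(1)[folded N] D_pow_carrier[folded N]
  note [simp] = mult_carrier_mat[of _ N N _ N]
  note assoc = assoc_mult_mat[of _ N N _ N _ N]
  have QDA: "QDA_mat R t a k = A * swap_mat * ?Dk * A_inv"
    by (simp add: QDA_mat_def Q_eq)
  have "QDA_mat R t a k ^\<^sub>m 2 = (A * swap_mat * ?Dk * A_inv) * (A * swap_mat * ?Dk * A_inv)"
    by (simp add: QDA numeral_2_eq_2 left_mult_one_mat[of _ N N])
  also have "\<dots> = A * swap_mat * ?Dk * ((A_inv * A) * (swap_mat * ?Dk * A_inv))"
    by (simp add: assoc)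
  also have "\<dots> = A * swap_mat * (?Dk * (swap_mat * ?Dk)) * A_inv"
    by (simp add: A_inv(3)[folded N] assoc left_mult_one_mat[of _ N N])
  also have "\<dots> = ?r \<cdot>\<^sub>m (A * (swap_mat * swap_mat) * A_inv)"
    unfolding D_swap_mat_D
    by (simp add: assoc mult_smult_distrib[of _ N N _ N] mult_smult_assoc_mat[of _ N N _ N])
  also have "\<dots> = ?r \<cdot>\<^sub>m 1\<^sub>m (t + 1)"
    by (simp add: swap_mat_square[folded N] A_inv(2) right_mult_one_mat[of _ N N])
  finally show ?thesis .
qed

text \<open>With \<open>Y = A\<^sup>-\<^sup>1 X\<close> the two sides of the identity become the two sides of \<open>macwilliams\<close>:
  \<open>x\<close> is an entry of \<open>A Y\<close> on the left, and \<open>Q D\<^sup>k Y\<close> is substituted on the right.\<close>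

lemma sse_dual:
  assumes C: "submodule C R V"
  shows "sse R n t a k (dual_code R n C) =
    pconst (1 / of_nat (card C) ^ k) * psubst_matrix t (QDA_mat R t a k) (sse R n t a k C)"
proof -
  note CV = submodule_subset[OF C]
  have DV: "dual_code R n C \<subseteq> carrier V" by (rule submodule_subset[OF submodule_dual[OF CV]])
  define y :: "nat \<Rightarrow> nat \<Rightarrow> (nat \<times> nat, rat) mpoly" where
    "y j l = (\<Sum>m\<in>{0..t}. pconst (A_inv $$ (j, m)) * pvar (m, l))" for j l
  \<comment> \<open>Substituting by M A^(-1) X is substituting by M Y. With M = A this recovers the
    variables themselves; with M = Q D^k it gives the right-hand side.\<close>
  have mult_entry: "(\<Sum>m\<in>{0..t}. pconst ((M * A_inv) $$ (i, m)) * pvar (m, l))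
      = (\<Sum>j\<in>{0..t}. pconst (M $$ (i, j)) * y j l)"
    if M: "M \<in> carrier_mat (t + 1) (t + 1)" and i: "i \<le> t" for M i l
  proof -
    have "(M * A_inv) $$ (i, m) = (\<Sum>j\<in>{0..t}. M $$ (i, j) * A_inv $$ (j, m))" if "m \<le> t" for m
      using M A_inv(1) i that
      by (simp add: scalar_prod_def atLeastLessThanSuc_atLeastAtMost less_Suc_eq_le)
    then have "(\<Sum>m\<in>{0..t}. pconst ((M * A_inv) $$ (i, m)) * pvar (m, l))
        = (\<Sum>m\<in>{0..t}. \<Sum>j\<in>{0..t}. pconst (M $$ (i, j)) * (pconst (A_inv $$ (j, m)) * pvar (m, l)))"
      by (simp add: pconst_sum pconst_mult sum_distrib_right mult.assoc)
    also have "\<dots> = (\<Sum>j\<in>{0..t}. pconst (M $$ (i, j)) * y j l)"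
      unfolding y_def sum_distrib_left by (rule sum.swap)
    finally show ?thesis .
  qed
  have x: "pvar (i, l) = (\<Sum>j\<in>{0..t}. if PIdl (a i) \<subseteq> PIdl (a j) then y j l else 0)"
    if i: "i \<le> t" for i l
  proof -
    have "(pvar (i, l) :: (nat \<times> nat, rat) mpoly) = (\<Sum>m\<in>{0..t}. if m = i then pvar (m, l) else 0)"
      using i by simp
    also have "\<dots> = (\<Sum>m\<in>{0..t}. pconst ((A * A_inv) $$ (i, m)) * pvar (m, l))"
      using i by (intro sum.cong) (auto simp: A_inv(2) pconst_0 pconst_1)
    also have "\<dots> = (\<Sum>j\<in>{0..t}. if PIdl (a i) \<subseteq> PIdl (a j) then y j l else 0)"
      unfolding mult_entry[OF carrier_mats(1) i]
      using i by (intro sum.cong) (auto simp: A_mat_def pconst_0 pconst_1 less_Suc_eq_le)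
    finally show ?thesis .
  qed
  have QDA: "(\<Sum>m\<in>{0..t}. pconst (QDA_mat R t a k $$ (i, m)) * pvar (m, l))
      = (\<Sum>j\<in>{0..t}. if PIdl (a i) \<subseteq> annihilator R (a j)
          then of_nat (card (PIdl (a j)) ^ k) * y j l else 0)" if i: "i \<le> t" for i l
  proof -
    have "Q * D ^\<^sub>m k \<in> carrier_mat (t + 1) (t + 1)"
      by (rule mult_carrier_mat[OF carrier_mats(2) D_pow_carrier])
    note e = mult_entry[OF this i]
    show ?thesis
      unfolding QDA_mat_def e
    proof (rule sum.cong[OF refl])
      fix j assume j: "j \<in> {0..t}"
      \<comment> \<open>D^k scales the columns of Q; the symmetry of the annihilator relation brings
        the condition into the form that \<open>macwilliams\<close> uses.\<close>
      have "(Q * D ^\<^sub>m k) $$ (i, j) = (if PIdl (a i) \<subseteq> annihilator R (a j)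
          then of_nat (card (PIdl (a j)) ^ k) else 0)"
        unfolding D_pow mat_diag_mult_right[OF carrier_mats(2)]
        using i j PIdl_subset_annihilator_iff[of i j] by (simp add: Q_mat_def)
      then show "pconst ((Q * D ^\<^sub>m k) $$ (i, j)) * y j l = (if PIdl (a i) \<subseteq> annihilator R (a j)
          then of_nat (card (PIdl (a j)) ^ k) * y j l else 0)"
        by (auto simp: pconst_0 pconst_of_nat simp del: of_nat_power)
    qed
  qed
  have "of_nat (card C ^ k) * sse R n t a k (dual_code R n C)
      = of_nat (card C ^ k) * (\<Sum>c\<in>{1..k} \<rightarrow>\<^sub>E dual_code R n C. \<Prod>l\<in>{1..n}. \<Sum>j\<in>{0..t}.
        if PIdl (a (col_index k c l)) \<subseteq> PIdl (a j) then y j l else 0)"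
    unfolding sse_eq_sum[OF DV]
    by (intro arg_cong2[of _ _ _ _ "(*)"] refl sum.cong prod.cong x col_index(1)[OF DV])
  also have "\<dots> = (\<Sum>c\<in>{1..k} \<rightarrow>\<^sub>E C. \<Prod>l\<in>{1..n}. \<Sum>j\<in>{0..t}.
        if PIdl (a (col_index k c l)) \<subseteq> annihilator R (a j)
        then of_nat (card (PIdl (a j)) ^ k) * y j l else 0)"
    by (rule macwilliams[OF C])
  also have "\<dots> = psubst_matrix t (QDA_mat R t a k) (sse R n t a k C)"
    unfolding psubst_matrix_def psubst_sse[OF CV] prod.case
    by (intro sum.cong prod.cong refl QDA[symmetric] col_index(1)[OF CV])
  finally have main: "of_nat (card C ^ k) * sse R n t a k (dual_code R n C)
      = psubst_matrix t (QDA_mat R t a k) (sse R n t a k C)" .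
  \<comment> \<open>A code contains the zero word, so the division by |C|^k is a genuine
    one.\<close>
  have "card C \<noteq> 0"
    using submodule_zero[OF C] submodule_finite[OF C] by auto
  then have "pconst (1 / of_nat (card C) ^ k) * of_nat (card C ^ k) = (1 :: (nat \<times> nat, rat) mpoly)"
    unfolding pconst_of_nat[symmetric] pconst_mult[symmetric] by (simp add: pconst_1)
  then show ?thesis
    unfolding main[symmetric] mult.assoc[symmetric] by simp
qed

end

theorem theorem17:
  fixes R :: "('r, 'm) ring_scheme"
    and n t k :: nat
    and a :: "nat \<Rightarrow> 'r"
    and C :: "(nat \<Rightarrow> 'r) set"
  assumes "finite_principal_ring R"
    and "t = card {I. (\<exists>c\<in>carrier R. I = PIdl\<^bsub>R\<^esub> c) \<and> I \<noteq> {\<zero>\<^bsub>R\<^esub>}}"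
    and "\<And>i. i \<in> {0..t} \<Longrightarrow> a i \<in> carrier R"
    and "inj_on (\<lambda>i. PIdl\<^bsub>R\<^esub> (a i)) {0..t}"
    and "linear_code R n C"
    and "k > 0"
  shows "sse R n t a k (dual_code R n C) =
           pconst (1 / of_nat (card C) ^ k) * psubst_matrix t (QDA_mat R t a k) (sse R n t a k C)
         \<and> QDA_mat R t a k ^\<^sub>m 2 = of_nat (card (carrier R)) ^ k \<cdot>\<^sub>m 1\<^sub>m (t + 1)"
proof -
  interpret indexed_principal_ideals R n t a
    using assms by (intro indexed_principal_ideals.intro code_space.intro
        indexed_principal_ideals_axioms.intro) auto
  show ?thesis
    using sse_dual[of C k] QDA_square[of k] assms(5) by (simp add: linear_code_def)
qed

end
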